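(* For $n\ge 3$ and an integer $r=r(n)\ge 3$, let $\boldsymbol{k}=\boldsymbol{k}(n)=(k_1,\ldots,k_n)$ be a sequence of non-negative integers with maximum entry $k_{\max}$ and sum $M(\boldsymbol{k})$. Assume that $r$ divides $M(\boldsymbol{k})$ for infinitely many values of $n$, and let $n\to\infty$ along these values. Let $X=X(n)$ be a given simple $r$-uniform hypergraph on the vertex set $V=\{v_1,\ldots,v_n\}$ with degree sequence $\boldsymbol{x}=(x_1,\ldots,x_n)$ and with $t=t(n)$ edges, where $x_i\le k_i$ for all $i=1,\ldots,n$. Define \[ \beta=\frac{r^4k_{\max}^3}{M(\boldsymbol{k}-\boldsymbol{x})}+\frac{t\,k_{\max}^3}{M(\boldsymbol{k}-\boldsymbol{x})^2}+\frac{r\,t\,k_{\max}^4}{M(\boldsymbol{k}-\boldsymbol{x})^3} \] and assume that $\beta=o(1)$. Then the probability that a uniformly random hypergraph from $\mathcal{H}_r(\boldsymbol{k})$ contains every edge of $X$ is \[ \frac{(M(\boldsymbol{k})/r)_t\;r!^{\,t}\,\prod_{i=1}^n (k_i)_{x_i}}{(M(\boldsymbol{k}))_{rt}}\,\exp\left(\frac{r-1}{2}\left(\frac{M_2(\boldsymbol{k})}{M(\boldsymbol{k})}-\frac{M_2(\boldsymbol{k}-\boldsymbol{x})}{M(\boldsymbol{k}-\boldsymbol{x})}\right)+O(\beta)\right). \]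
   Context: A simple $r$-uniform hypergraph on the vertex set $V=\{v_1,\ldots,v_n\}$ is a set of $r$-element subsets of $V$ (its edges); no loops and no repeated edges are allowed. The degree sequence lists the degree of $v_1,\ldots,v_n$ in order. $\mathcal{H}_r(\boldsymbol{k})$ is the set of all simple $r$-uniform hypergraphs on $V$ with degree sequence $\boldsymbol{k}$. Notation: $(a)_b=a(a-1)\cdots(a-b+1)$ is the falling factorial; for a sequence $\boldsymbol{y}=(y_1,\ldots,y_n)$ of non-negative integers, $M(\boldsymbol{y})=\sum_{i=1}^n y_i$ and $M_2(\boldsymbol{y})=\sum_{i=1}^n (y_i)_2$. All asymptotics are as $n\to\infty$ along values of $n$ for which $r$ divides $M(\boldsymbol{k})$. *)

theory Defs
  imports "HOL-Probability.Probability_Mass_Function" "HOL-Library.Landau_Symbols"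
begin

text \<open>
  The vertices \<open>v\<^sub>1, \<dots>, v\<^sub>n\<close> are the numbers \<open>1, \<dots>, n\<close>. A simple \<open>r\<close>-uniform hypergraph is
  identified with its set of edges. A sequence \<open>(y\<^sub>1, \<dots>, y\<^sub>n)\<close> is a function
  \<^typ>\<open>nat \<Rightarrow> nat\<close>, of which only the values on \<open>{1..n}\<close> are used.
\<close>

definition hdegree :: "nat set set \<Rightarrow> nat \<Rightarrow> nat" where
  "hdegree H v = card {e \<in> H. v \<in> e}"

definition simple_uniform_hypergraphs :: "nat \<Rightarrow> nat \<Rightarrow> nat set set set" where
  "simple_uniform_hypergraphs n r = {H. \<forall>e\<in>H. e \<subseteq> {1..n} \<and> card e = r}"

definition hypergraphs_with_degrees :: "nat \<Rightarrow> nat \<Rightarrow> (nat \<Rightarrow> nat) \<Rightarrow> nat set set set" where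
  "hypergraphs_with_degrees n r k =
     {H \<in> simple_uniform_hypergraphs n r. \<forall>i\<in>{1..n}. hdegree H i = k i}"

definition falling_factorial :: "real \<Rightarrow> nat \<Rightarrow> real" where
  "falling_factorial a b = (\<Prod>i<b. a - real i)"

definition M :: "nat \<Rightarrow> (nat \<Rightarrow> nat) \<Rightarrow> nat" where
  "M n y = (\<Sum>i=1..n. y i)"

definition M2 :: "nat \<Rightarrow> (nat \<Rightarrow> nat) \<Rightarrow> real" where
  "M2 n y = (\<Sum>i=1..n. falling_factorial (real (y i)) 2)"

definition k_max :: "nat \<Rightarrow> (nat \<Rightarrow> nat) \<Rightarrow> nat" where
  "k_max n k = Max (k ` {1..n})"

text \<open>
  The difference \<open>k - x\<close> is truncated subtraction; below it is only used with \<open>x \<le> k\<close>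
  on \<open>{1..n}\<close>. If \<open>M(k - x) = 0\<close>, the mathematical expression is undefined, whereas the
  value of \<open>beta\<close> is 0; statements about \<open>beta\<close> must exclude this case.
\<close>

definition beta :: "nat \<Rightarrow> nat \<Rightarrow> (nat \<Rightarrow> nat) \<Rightarrow> (nat \<Rightarrow> nat) \<Rightarrow> nat \<Rightarrow> real" where
  "beta n r k x t =
     real r ^ 4 * real (k_max n k) ^ 3 / real (M n (\<lambda>i. k i - x i))
     + real t * real (k_max n k) ^ 3 / real (M n (\<lambda>i. k i - x i)) ^ 2
     + real r * real t * real (k_max n k) ^ 4 / real (M n (\<lambda>i. k i - x i)) ^ 3"

text \<open>The filter of \<open>n \<rightarrow> \<infinity>\<close> along the values of \<open>n\<close> in \<open>N\<close>.\<close>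

definition to_infinity_along :: "nat set \<Rightarrow> nat filter" where
  "to_infinity_along N = inf sequentially (principal N)"

end

theory Submission
  imports Defs
begin

text \<open>
  In the configuration model every vertex \<open>i\<close> is replaced by \<open>k i\<close> points, and the points are
  distributed uniformly over \<open>m = M(k)/r\<close> labels with \<open>r\<close> points each. A hypergraph with degrees
  \<open>k\<close> corresponds to exactly \<open>m! \<Prod> k\<^sub>i!\<close> distributions, namely those in which no label holds two
  points of one vertex and no two labels induce the same edge. Instead of switching away all loops
  at once, the pairs of points of a common vertex are forbidden one after the other: if some pairs,
  at most \<open>d\<close> at each point, are already separated, a further pair \<open>p, q\<close> shares a label with
  conditional probability \<open>(r - 1)/M + O(r\<^sup>2 d/M\<^sup>2)\<close>, as is seen by exchanging the labels of \<open>q\<close> and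
  of another point. Multiplying over the \<open>M\<^sub>2/2\<close> pairs gives \<open>exp(-(r - 1) M\<^sub>2/(2 M) + O(r\<^sup>2 k\<^sup>2/M))\<close>
  for the probability that there are no loops, and the same exchange shows that, given this, a
  repeated edge or an edge of \<open>X\<close> occurs with probability \<open>O(\<beta>)\<close>. The hypergraphs that contain \<open>X\<close>
  correspond to those with degrees \<open>k - x\<close> that avoid \<open>X\<close>; the result is the quotient of the two
  counts.
\<close>

section \<open>Balanced maps separating the edges of a graph\<close>

definition balanced_maps :: "'a set \<Rightarrow> 'b set \<Rightarrow> nat \<Rightarrow> ('a \<Rightarrow> 'b) set" where
  "balanced_maps S C r = {b \<in> S \<rightarrow>\<^sub>E C. \<forall>c\<in>C. card {p \<in> S. b p = c} = r}"

definition proper_maps :: "'a set \<Rightarrow> 'b set \<Rightarrow> nat \<Rightarrow> 'a set set \<Rightarrow> ('a \<Rightarrow> 'b) set" where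
  "proper_maps S C r E =
     {b \<in> balanced_maps S C r. \<forall>u\<in>S. \<forall>v\<in>S. {u, v} \<in> E \<longrightarrow> b u \<noteq> b v}"

lemma finite_balanced_maps: "finite S \<Longrightarrow> finite C \<Longrightarrow> finite (balanced_maps S C r)"
  unfolding balanced_maps_def by (simp add: finite_PiE)

lemma finite_proper_maps: "finite S \<Longrightarrow> finite C \<Longrightarrow> finite (proper_maps S C r E)"
  unfolding proper_maps_def by (simp add: finite_balanced_maps)

section \<open>Exchanging the labels of two points\<close>

lemma balanced_maps_fiber:
  assumes "b \<in> balanced_maps S C r" "p \<in> S"
  shows "card {z \<in> S. b z = b p} = r"
  using assms by (auto simp: balanced_maps_def)

lemma balanced_maps_comp_transpose:
  assumes b: "b \<in> balanced_maps S C r" and q: "q \<in> S" and z: "z \<in> S"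
  shows "b \<circ> Transposition.transpose q z \<in> balanced_maps S C r"
proof -
  have S: "Transposition.transpose q z p \<in> S \<longleftrightarrow> p \<in> S" for p
    using q z by (auto simp: Transposition.transpose_def)
  have "b \<circ> Transposition.transpose q z \<in> S \<rightarrow>\<^sub>E C"
    using b q z S by (auto simp: balanced_maps_def PiE_iff extensional_def)
  moreover have "card {p \<in> S. b (Transposition.transpose q z p) = c} = r" if "c \<in> C" for c
  proof -
    have "{p \<in> S. b (Transposition.transpose q z p) = c} = Transposition.transpose q z ` {p \<in> S. b p = c}"
      using S by (auto simp: image_iff) (metis transpose_involutory)
    then show ?thesis
      using b that by (simp add: card_image balanced_maps_def)
  qed
  ultimately show ?thesis
    by (simp add: balanced_maps_def)
qed

text \<open>Only pairs that meet \<open>q\<close> or \<open>z\<close> change status. The last two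
  hypotheses test the neighbours of each of these points against the label it receives, in terms of
  the old \<open>b\<close>; the pair \<open>{q, z}\<close> is exempt because its two labels merely
  trade places.\<close>

lemma proper_maps_comp_transpose:
  assumes b: "b \<in> proper_maps S C r E" and q: "q \<in> S" and z: "z \<in> S"
    and qE: "\<And>v. v \<in> S \<Longrightarrow> {q, v} \<in> E \<Longrightarrow> v \<noteq> z \<Longrightarrow> b v \<noteq> b z"
    and zE: "\<And>v. v \<in> S \<Longrightarrow> {z, v} \<in> E \<Longrightarrow> v \<noteq> q \<Longrightarrow> b v \<noteq> b q"
  shows "b \<circ> Transposition.transpose q z \<in> proper_maps S C r E"
proof -
  have E: "b u \<noteq> b v" if "u \<in> S" "v \<in> S" "{u, v} \<in> E" for u v
    using b that by (auto simp: proper_maps_def)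
  have "(b \<circ> Transposition.transpose q z) u \<noteq> (b \<circ> Transposition.transpose q z) v"
    if uv: "u \<in> S" "v \<in> S" "{u, v} \<in> E" for u v
  proof -
    have vu: "{v, u} \<in> E" using uv by (simp add: insert_commute)
    have ne: "u \<noteq> v" using E[OF uv] by auto
    consider "u = q" | "u = z" | "v = q" "u \<noteq> z" "u \<noteq> q" | "v = z" "u \<noteq> q" "u \<noteq> z"
      | "u \<notin> {q, z}" "v \<notin> {q, z}" by auto
    then show ?thesis
    proof cases
      case 1
      then show ?thesis
        using qE[of v] uv E[OF uv] ne by (cases "v = z") (auto simp: Transposition.transpose_def)
    next
      case 2
      then show ?thesis
        using zE[of v] uv E[OF uv] ne by (cases "v = q") (auto simp: Transposition.transpose_def)
    next
      case 3
      then show ?thesis using qE[of u] uv vu by (auto simp: Transposition.transpose_def)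
    next
      case 4
      then show ?thesis using zE[of u] uv vu by (auto simp: Transposition.transpose_def)
    next
      case 5
      then show ?thesis using E[OF uv] by (auto simp: Transposition.transpose_def)
    qed
  qed
  with b balanced_maps_comp_transpose[OF _ q z] show ?thesis
    unfolding proper_maps_def by blast
qed

text \<open>A stage of the process that forbids pairs one by one: \<open>E\<close> holds the pairs
  already separated, and \<open>card S\<close> plays the role of M(k). The bound \<open>d\<close>
  controls how many exchanges can destroy an earlier separation.\<close>

locale conflict_graph =
  fixes S :: "'a set" and C :: "'b set" and r d :: nat and E :: "'a set set"
  assumes finite_S: "finite S" and finite_C: "finite C"
    and degree_le: "\<And>u. u \<in> S \<Longrightarrow> card {v \<in> S. {u, v} \<in> E} \<le> d"
begin

abbreviation "W \<equiv> proper_maps S C r E"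
abbreviation "nbh u \<equiv> {v \<in> S. {u, v} \<in> E}"

lemmas finite_W = finite_proper_maps[OF finite_S finite_C, of r E]

lemma W_balanced: "b \<in> W \<Longrightarrow> b \<in> balanced_maps S C r"
  by (simp add: proper_maps_def)

lemma W_proper: "b \<in> W \<Longrightarrow> u \<in> S \<Longrightarrow> v \<in> nbh u \<Longrightarrow> b u \<noteq> b v"
  by (simp add: proper_maps_def)

lemma card_fiber: "b \<in> W \<Longrightarrow> p \<in> S \<Longrightarrow> card {z \<in> S. b z = b p} = r"
  by (rule balanced_maps_fiber[OF W_balanced])

lemma card_fiber_minus:
  assumes "b \<in> W" "p \<in> S" shows "card {z \<in> S. z \<noteq> p \<and> b z = b p} = r - 1"
proof -
  have "{z \<in> S. z \<noteq> p \<and> b z = b p} = {z \<in> S. b z = b p} - {p}" by auto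
  then show ?thesis using card_fiber[OF assms] assms finite_S by simp
qed

text \<open>Union bound over the unusable \<open>z\<close>: the \<open>r\<close> points labelled
  \<open>b p\<close>; at most \<open>r * d\<close> points sharing a label with a neighbour of
  \<open>q\<close>; at most \<open>r * d\<close> neighbours of the points labelled
  \<open>b q\<close>; and the points of \<open>F\<close>, whose labels are to stay
  untouched.\<close>

lemma switchings_ge:
  assumes b: "b \<in> W" and p: "p \<in> S" and q: "q \<in> S" and bpq: "b p = b q" and F: "finite F"
  shows "real (card S) - (r + 2 * r * d + card F)
    \<le> card {z \<in> S. b z \<noteq> b p \<and> z \<notin> F \<and> b \<circ> Transposition.transpose q z \<in> W}" (is "_ \<le> real (card ?G)")
proof -
  let ?B1 = "{z \<in> S. b z = b p}"
  let ?B2 = "\<Union>v\<in>nbh q. {z \<in> S. b z = b v}"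
  let ?B3 = "\<Union>v\<in>{v \<in> S. b v = b q}. nbh v"
  have "S \<subseteq> ?G \<union> (?B1 \<union> (?B2 \<union> (?B3 \<union> F)))"
  proof
    fix z assume z: "z \<in> S"
    show "z \<in> ?G \<union> (?B1 \<union> (?B2 \<union> (?B3 \<union> F)))"
    proof (rule ccontr)
      assume no: "\<not> ?thesis"
      have "b \<circ> Transposition.transpose q z \<in> W"
      proof (rule proper_maps_comp_transpose[OF b q z])
        fix v assume "v \<in> S" "{q, v} \<in> E" then show "b v \<noteq> b z" using no z by auto
      next
        fix v assume "v \<in> S" "{z, v} \<in> E" then show "b v \<noteq> b q"
          using no z by (auto simp: insert_commute)
      qed
      with no z show False by auto
    qed
  qed
  then have "card S \<le> card (?G \<union> (?B1 \<union> (?B2 \<union> (?B3 \<union> F))))"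
    using finite_S F by (intro card_mono) auto
  also have "\<dots> \<le> card ?G + (card ?B1 + (card ?B2 + (card ?B3 + card F)))"
    by (meson card_Un_le add_left_mono order_trans)
  also have "card ?B1 = r" using card_fiber[OF b p] .
  also have "card ?B2 \<le> (\<Sum>v\<in>nbh q. card {z \<in> S. b z = b v})"
    using finite_S by (intro card_UN_le) auto
  also have "\<dots> = r * card (nbh q)"
    using card_fiber[OF b] by simp
  also have "\<dots> \<le> r * d" using degree_le[OF q] by simp
  also have "card ?B3 \<le> (\<Sum>v\<in>{v \<in> S. b v = b q}. card (nbh v))"
    using finite_S by (intro card_UN_le) auto
  also have "\<dots> \<le> (\<Sum>v\<in>{v \<in> S. b v = b q}. d)"
    using degree_le by (intro sum_mono) auto
  also have "\<dots> = r * d" using card_fiber[OF b q] by simp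
  finally have "card S \<le> card ?G + (r + (r * d + (r * d + card F)))" by linarith
  then have "real (card S) \<le> real (card ?G + (r + (r * d + (r * d + card F))))"
    by (rule of_nat_mono)
  then show ?thesis by (simp add: algebra_simps)
qed

text \<open>The transposition is an involution; recording \<open>z\<close> beside the map makes the
  switch reversible.\<close>

lemma inj_on_switch:
  "inj_on (\<lambda>(b, z). (b \<circ> Transposition.transpose q z, z)) A"
  by (rule inj_on_inverseI[where g = "\<lambda>(b, z). (b \<circ> Transposition.transpose q z, z)"])
    (auto simp: comp_assoc)

text \<open>Double counting of pairs \<open>(b, z)\<close>. A switch from \<open>b q = b p\<close>
  leaves \<open>z\<close> with the label of \<open>p\<close>, so each target arises from at most
  \<open>r - 1\<close> choices of \<open>z\<close>. Neither \<open>q\<close> nor \<open>z\<close>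
  lies in \<open>F\<close>, so an event \<open>Q\<close> that is read off from \<open>F\<close>
  survives the switch; this permits conditioning on \<open>Q\<close>.\<close>

lemma switching_upper:
  assumes p: "p \<in> S" and q: "q \<in> S" and pq: "p \<noteq> q" and F: "finite F" and qF: "q \<notin> F"
    and Q: "\<And>b b'. (\<And>x. x \<in> F \<Longrightarrow> b x = b' x) \<Longrightarrow> Q b \<Longrightarrow> Q b'"
  shows "real (card {b \<in> W. Q b \<and> b q = b p}) * (real (card S) - (r + 2 * r * d + card F))
    \<le> real (r - 1) * card {b \<in> W. Q b \<and> b q \<noteq> b p}"
proof -
  let ?A = "{b \<in> W. Q b \<and> b q = b p}" and ?A' = "{b \<in> W. Q b \<and> b q \<noteq> b p}"
  let ?G = "\<lambda>b. {z \<in> S. b z \<noteq> b p \<and> z \<notin> F \<and> b \<circ> Transposition.transpose q z \<in> W}"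
  let ?G' = "\<lambda>b. {z \<in> S. z \<noteq> p \<and> b z = b p}"
  let ?\<phi> = "\<lambda>(b, z). (b \<circ> Transposition.transpose q z, z)"
  have fin: "finite ?A" "finite ?A'" using finite_W by auto
  have "real (card ?A) * (real (card S) - (r + 2 * r * d + card F))
      = (\<Sum>b\<in>?A. real (card S) - (r + 2 * r * d + card F))" by simp
  also have "\<dots> \<le> (\<Sum>b\<in>?A. real (card (?G b)))"
    using switchings_ge[OF _ p q _ F] by (intro sum_mono) (auto dest: sym)
  also have "\<dots> = card (Sigma ?A ?G)"
    using fin finite_S by simp
  also have "card (Sigma ?A ?G) \<le> card (Sigma ?A' ?G')"
  proof (rule card_inj_on_le[OF inj_on_switch])
    show "?\<phi> ` Sigma ?A ?G \<subseteq> Sigma ?A' ?G'"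
    proof (clarify)
      fix b z assume *: "b \<in> W" "Q b" "b q = b p" "z \<in> S" "b z \<noteq> b p" "z \<notin> F"
        "b \<circ> Transposition.transpose q z \<in> W"
      have zp: "z \<noteq> p" "z \<noteq> q" using * by auto
      have "Q (b \<circ> Transposition.transpose q z)"
        using \<open>Q b\<close> qF \<open>z \<notin> F\<close> by (rule_tac Q[of b]) (auto simp: Transposition.transpose_def)
      then show "b \<circ> Transposition.transpose q z \<in> ?A' \<and> z \<in> ?G' (b \<circ> Transposition.transpose q z)"
        using * zp pq by (auto simp: Transposition.transpose_def)
    qed
    show "finite (Sigma ?A' ?G')" using fin finite_S by auto
  qed
  also have "card (Sigma ?A' ?G') = (\<Sum>b\<in>?A'. card (?G' b))"
    using fin finite_S by simp
  also have "\<dots> = (r - 1) * card ?A'"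
    using card_fiber_minus[OF _ p] by simp
  finally show ?thesis by simp
qed


text \<open>The hypothesis \<open>large\<close> keeps the number of admissible exchanges at least
  \<open>card S / 2\<close>. The bound 8 leaves room for the endpoints of four earlier requirements,
  as needed for chains of length five.\<close>

lemma coincidence_le:
  assumes large: "2 * (r + 2 * r * d + 8) \<le> card S"
    and p: "p \<in> S" and q: "q \<in> S" and pq: "p \<noteq> q"
    and F: "finite F" "card F \<le> 8" and qF: "q \<notin> F"
    and Q: "\<And>b b'. (\<And>x. x \<in> F \<Longrightarrow> b x = b' x) \<Longrightarrow> Q b \<Longrightarrow> Q b'"
  shows "real (card {b \<in> W. Q b \<and> b q = b p}) \<le> 2 * r / card S * card {b \<in> W. Q b}"
proof -
  let ?a = "real (card {b \<in> W. Q b \<and> b q = b p})" and ?M = "real (card S)"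
  have M: "?M > 0" using large by auto
  have "real (2 * (r + 2 * r * d + 8)) \<le> ?M" using large by (rule of_nat_mono)
  then have "?M / 2 \<le> ?M - (r + 2 * r * d + card F)"
    using F(2) by (simp add: algebra_simps)
  then have "?a * (?M / 2) \<le> ?a * (?M - (r + 2 * r * d + card F))"
    by (rule mult_left_mono) simp
  also have "\<dots> \<le> real (r - 1) * card {b \<in> W. Q b \<and> b q \<noteq> b p}"
    by (rule switching_upper[OF p q pq F(1) qF Q])
  also have "\<dots> \<le> real r * card {b \<in> W. Q b}"
    using finite_W by (intro mult_mono of_nat_mono card_mono) auto
  finally show ?thesis using M by (simp add: field_simps)
qed

text \<open>
  Each pair \<open>(q, p)\<close> stands for the requirement \<open>b q = b p\<close>; the freshness of \<open>q\<close> makes the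
  requirements form a forest that grows leaf by leaf, towards the head of the list.
\<close>

fun fresh_pairs :: "('a \<times> 'a) list \<Rightarrow> bool" where
  "fresh_pairs [] = True"
| "fresh_pairs ((q, p) # l) \<longleftrightarrow>
     q \<in> S \<and> p \<in> S \<and> q \<noteq> p \<and> q \<notin> fst ` set l \<union> snd ` set l \<and> fresh_pairs l"

text \<open>Chain rule: given the requirements in the tail, the head point is fresh, so its label
  can be exchanged without touching them. Each requirement costs one factor
  \<open>2 * r / card S\<close>.\<close>

lemma coincidences_le:
  assumes large: "2 * (r + 2 * r * d + 8) \<le> card S"
    and "fresh_pairs l" and "length l \<le> 5"
  shows "real (card {b \<in> W. \<forall>(q, p)\<in>set l. b q = b p}) \<le> (2 * r / card S) ^ length l * card W"
  using assms(2,3)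
proof (induction l)
  case (Cons a l)
  obtain q p where a: "a = (q, p)" by force
  let ?F = "fst ` set l \<union> snd ` set l"
  let ?Q = "\<lambda>b. \<forall>(q, p)\<in>set l. b q = (b p :: 'b)"
  have "card ?F \<le> card (fst ` set l) + card (snd ` set l)" by (rule card_Un_le)
  also have "\<dots> \<le> length l + length l"
    by (intro add_mono order_trans[OF card_image_le card_length]) auto
  finally have cF: "card ?F \<le> 8" using Cons.prems by simp
  have "real (card {b \<in> W. ?Q b \<and> b q = b p}) \<le> 2 * r / card S * card {b \<in> W. ?Q b}"
  proof (rule coincidence_le[OF large _ _ _ _ cF])
    fix b b' :: "'a \<Rightarrow> 'b" assume eq: "\<And>x. x \<in> ?F \<Longrightarrow> b x = b' x" and Q: "?Q b"
    have "b' q = b' p" if "(q, p) \<in> set l" for q p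
    proof -
      have "q \<in> ?F" "p \<in> ?F" using that by force+
      then show ?thesis using eq[of q] eq[of p] Q that by auto
    qed
    then show "?Q b'" by blast
  qed (use Cons.prems a in auto)
  also have "\<dots> \<le> 2 * r / card S * ((2 * r / card S) ^ length l * card W)"
    using Cons by (intro mult_left_mono) (auto simp: a)
  finally show ?case by (simp add: a conj_commute mult.assoc)
qed simp

text \<open>Switching in both directions. The upper bound is \<open>switching_upper\<close>; for the
  lower bound, exchanges that start from \<open>b q \<noteq> b p\<close> are counted, and those that
  break an earlier separation are estimated by the crude coincidence bounds.\<close>

lemma coincidence_sharp:
  assumes large: "2 * (r + 2 * r * d + 8) \<le> card S" and r: "r \<ge> 1" and d: "d \<ge> 1"
    and p: "p \<in> S" and q: "q \<in> S" and pq: "p \<noteq> q" and pqE: "{p, q} \<notin> E"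
  shows "\<bar>real (card {b \<in> W. b q = b p}) - (real r - 1) / card S * card W\<bar>
    \<le> 12 * real r ^ 2 * d / real (card S) ^ 2 * card W"
proof -
  define M where "M = real (card S)"
  define a where "a = real (card {b \<in> W. b q = b p})"
  define w where "w = real (card W)"
  let ?A = "{b \<in> W. b q = b p}" and ?A' = "{b \<in> W. b q \<noteq> b p}"
  have "real (2 * (r + 2 * r * d + 8)) \<le> card S" using large by (rule of_nat_mono)
  then have Mlarge: "2 * (r + 2 * r * d + 8) \<le> M" by (simp add: M_def)
  have M: "M > 0" using large by (simp add: M_def)
  have fin: "finite ?A" "finite ?A'" using finite_W by auto
  have "card (?A \<union> ?A') = card ?A + card ?A'"
    using fin by (intro card_Un_disjoint) auto
  moreover have "?A \<union> ?A' = W" by auto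
  ultimately have "card W = card ?A + card ?A'" by simp
  then have wa: "real (card ?A') = w - a" by (simp add: w_def a_def)
  have a0: "a \<ge> 0" "w \<ge> 0" by (auto simp: a_def w_def)
  have crude: "a \<le> 2 * r / M * w"
    using coincidence_le[OF large p q pq, of "{}" "\<lambda>_. True"] by (simp add: a_def M_def w_def)

  have "a * (M - (r + 2 * r * d)) \<le> (real r - 1) * (w - a)"
    using switching_upper[OF p q pq, of "{}" "\<lambda>_. True"] r wa
    by (simp add: a_def M_def of_nat_diff)
  then have upper: "a * M \<le> (real r - 1) * w + a * (1 + 2 * r * d)"
    by (simp add: algebra_simps)

  let ?G = "\<lambda>b. {z \<in> S. b z \<noteq> b p}"
  let ?G' = "\<lambda>b. {z \<in> S. z \<noteq> p \<and> b z = b p}"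
  \<comment> \<open>The reverse switch gives \<open>q\<close> the label of \<open>p\<close>, taken
    from another point \<open>z\<close> of that fibre. It fails only if a neighbour of
    \<open>q\<close> carries the label of \<open>p\<close> (\<open>?B1\<close>) or a neighbour of
    \<open>z\<close> carries the old label of \<open>q\<close> (\<open>?B2\<close>).\<close>
  let ?ok = "{(b, z) \<in> Sigma ?A' ?G'. b \<circ> Transposition.transpose q z \<in> W}"
  let ?B1 = "\<Union>u\<in>nbh q. Sigma {b \<in> W. b u = b p} ?G'"
  let ?B2 = "\<Union>z\<in>S - {p}. \<Union>v\<in>nbh z - {q}. {b \<in> W. b v = b q \<and> b z = b p} \<times> {z}"
  have sub: "Sigma ?A' ?G' \<subseteq> ?ok \<union> (?B1 \<union> ?B2)"
  proof
    fix x assume x: "x \<in> Sigma ?A' ?G'"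
    then obtain b z where bz: "x = (b, z)" "b \<in> W" "b q \<noteq> b p" "z \<in> S" "z \<noteq> p" "b z = b p"
      by auto
    show "x \<in> ?ok \<union> (?B1 \<union> ?B2)"
    proof (rule ccontr)
      assume no: "\<not> ?thesis"
      have "b \<circ> Transposition.transpose q z \<in> W"
      proof (rule proper_maps_comp_transpose[OF \<open>b \<in> W\<close> q \<open>z \<in> S\<close>])
        fix v assume "v \<in> S" "{q, v} \<in> E" then show "b v \<noteq> b z" using no bz by auto
      next
        fix v assume "v \<in> S" "{z, v} \<in> E" "v \<noteq> q" then show "b v \<noteq> b q"
          using no bz by auto
      qed
      with no x bz show False by auto
    qed
  qed
  have cok: "card ?ok \<le> card (Sigma ?A ?G)"
  proof (rule card_inj_on_le[OF inj_on_switch])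
    show "(\<lambda>(b, z). (b \<circ> Transposition.transpose q z, z)) ` ?ok \<subseteq> Sigma ?A ?G"
      using pq by (auto simp: Transposition.transpose_def)
    show "finite (Sigma ?A ?G)" using fin finite_S by auto
  qed
  have cG: "card (Sigma ?A ?G) = (\<Sum>b\<in>?A. card S - r)"
  proof -
    have "card (?G b) = card S - r" if "b \<in> ?A" for b
    proof -
      have "?G b = S - {z \<in> S. b z = b p}" by auto
      then show ?thesis
        using card_fiber[of b p] that p finite_S by (simp add: card_Diff_subset)
    qed
    then show ?thesis using fin finite_S by simp
  qed
  have "real (card ?ok) \<le> real (\<Sum>b\<in>?A. card S - r)"
    using cok unfolding cG by (rule of_nat_mono)
  also have "\<dots> = a * (M - r)"
    using large by (simp add: a_def M_def of_nat_diff)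
  finally have ok_le: "real (card ?ok) \<le> a * (M - r)" .

  have "real (card ?B1) \<le> (\<Sum>u\<in>nbh q. real (card (Sigma {b \<in> W. b u = b p} ?G')))"
    using finite_S by (subst of_nat_sum[symmetric], intro of_nat_mono card_UN_le) auto
  also have "\<dots> \<le> (\<Sum>u\<in>nbh q. r * (2 * r / M * w))"
  proof (rule sum_mono)
    fix u assume u: "u \<in> nbh q"
    then have up: "u \<noteq> p" using pqE by (auto simp: insert_commute)
    have "card (Sigma {b \<in> W. b u = b p} ?G') = (\<Sum>b\<in>{b \<in> W. b u = b p}. card (?G' b))"
      using finite_W finite_S by simp
    also have "\<dots> = (r - 1) * card {b \<in> W. b u = b p}"
      using card_fiber_minus[OF _ p] by simp
    also have "\<dots> \<le> r * card {b \<in> W. b u = b p}" by simp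
    finally have "real (card (Sigma {b \<in> W. b u = b p} ?G')) \<le> real (r * card {b \<in> W. b u = b p})"
      by (rule of_nat_mono)
    also have "\<dots> = r * real (card {b \<in> W. b u = b p})" by (rule of_nat_mult)
    also have "\<dots> \<le> r * (2 * r / M * w)"
      using coincidence_le[OF large p _ up[symmetric], of "{}" "\<lambda>_. True"] u
      by (intro mult_left_mono) (auto simp: M_def w_def)
    finally show "real (card (Sigma {b \<in> W. b u = b p} ?G')) \<le> r * (2 * r / M * w)" .
  qed
  also have "\<dots> = real (card (nbh q)) * (r * (2 * r / M * w))" by simp
  also have "\<dots> \<le> d * (r * (2 * r / M * w))"
    using degree_le[OF q] M a0 by (intro mult_right_mono) auto
  finally have B1: "real (card ?B1) \<le> 2 * r\<^sup>2 * d / M * w"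
    by (simp add: power2_eq_square mult_ac)

  have "real (card ?B2) \<le>
      (\<Sum>z\<in>S - {p}. \<Sum>v\<in>nbh z - {q}. real (card ({b \<in> W. b v = b q \<and> b z = b p} \<times> {z})))"
    using finite_S
    by (simp only: of_nat_sum[symmetric], intro of_nat_mono order_trans[OF card_UN_le]
      sum_mono card_UN_le) auto
  also have "\<dots> \<le> (\<Sum>z\<in>S - {p}. \<Sum>v\<in>nbh z - {q}. (2 * r / M) ^ 2 * w)"
  proof (intro sum_mono)
    fix z v assume z: "z \<in> S - {p}" and v: "v \<in> nbh z - {q}"
    show "real (card ({b \<in> W. b v = b q \<and> b z = b p} \<times> {z})) \<le> (2 * r / M) ^ 2 * w"
    \<comment> \<open>In the degenerate cases the coincidence contradicts properness, since
      \<open>v\<close> is a neighbour of \<open>z\<close>. Otherwise the two requirements form a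
      fresh list and cost \<open>(2 * r / M) ^ 2\<close>.\<close>
    proof (cases "v = p \<or> v = z")
      case True
      have "{b \<in> W. b v = b q \<and> b z = b p} = {}"
      proof (rule ccontr)
        assume "\<not> ?thesis"
        then obtain b where "b \<in> W" "b z = b p" by auto
        with W_proper[of b z v] z v True show False by auto
      qed
      then show ?thesis using a0 by (simp del: Collect_empty_eq)
    next
      case False
      then show ?thesis
        using coincidences_le[OF large, of "[(v, q), (z, p)]"] z v p q
        by (simp add: M_def w_def card_cartesian_product power2_eq_square)
    qed
  qed
  also have "\<dots> \<le> (\<Sum>z\<in>S - {p}. d * ((2 * r / M) ^ 2 * w))"
  proof (rule sum_mono)
    fix z assume "z \<in> S - {p}"
    then have "card (nbh z) \<le> d" using degree_le[of z] by simp
    then have "card (nbh z - {q}) \<le> d" by (rule order_trans[OF card_Diff1_le])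
    then show "(\<Sum>v\<in>nbh z - {q}. (2 * r / M) ^ 2 * w) \<le> d * ((2 * r / M) ^ 2 * w)"
      using a0 by (simp add: mult_right_mono)
  qed
  also have "\<dots> \<le> (\<Sum>z\<in>S. d * ((2 * r / M) ^ 2 * w))"
    using finite_S a0 by (intro sum_mono2) auto
  also have "\<dots> = 4 * r\<^sup>2 * d / M * w"
    using M by (simp add: M_def[symmetric] power2_eq_square field_simps)
  finally have B2: "real (card ?B2) \<le> 4 * r\<^sup>2 * d / M * w" .

  have "(r - 1) * card ?A' = card (Sigma ?A' ?G')"
    using fin finite_S card_fiber_minus[OF _ p] by simp
  also have "\<dots> \<le> card (?ok \<union> (?B1 \<union> ?B2))"
  proof (rule card_mono[OF _ sub])
    have "finite ?ok" by (rule finite_subset[of _ "Sigma ?A' ?G'"]) (use fin finite_S in auto)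
    moreover have "finite ?B1" "finite ?B2" using finite_S finite_W by auto
    ultimately show "finite (?ok \<union> (?B1 \<union> ?B2))" by blast
  qed
  also have "\<dots> \<le> card ?ok + (card ?B1 + card ?B2)"
    by (meson card_Un_le add_left_mono order_trans)
  finally have "real ((r - 1) * card ?A') \<le> real (card ?ok + (card ?B1 + card ?B2))"
    by (rule of_nat_mono)
  also have "\<dots> \<le> a * (M - r) + (2 * r\<^sup>2 * d / M * w + 4 * r\<^sup>2 * d / M * w)"
    unfolding of_nat_add by (intro add_mono ok_le B1 B2)
  also have "real ((r - 1) * card ?A') = (real r - 1) * (w - a)"
    using r wa by (simp add: of_nat_diff)
  finally have "(real r - 1) * (w - a)
      \<le> a * (M - r) + (2 * r\<^sup>2 * d / M * w + 4 * r\<^sup>2 * d / M * w)" .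
  then have lower: "(real r - 1) * w \<le> a * M + 6 * r\<^sup>2 * d / M * w"
    using a0 by (simp add: algebra_simps)

  \<comment> \<open>The surplus in \<open>upper\<close> comes from the unusable exchanges; the crude
    bound on \<open>a\<close> brings it to the same order as the error in
    \<open>lower\<close>.\<close>
  have "a * (1 + 2 * real r * d) \<le> (2 * r / M * w) * (3 * r * d)"
  proof (rule mult_mono[OF crude])
    have "real 1 \<le> real (d * r)" using r d by (intro of_nat_mono) simp
    then show "1 + 2 * real r * d \<le> 3 * r * d" by simp
  qed (use M a0 in auto)
  also have "\<dots> = 6 * r\<^sup>2 * d / M * w" by (simp add: power2_eq_square)
  finally have "\<bar>a * M - (real r - 1) * w\<bar> \<le> 6 * r\<^sup>2 * d / M * w"
    using upper lower by (simp add: abs_le_iff)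
  then have "\<bar>a * M - (real r - 1) * w\<bar> / M \<le> 6 * r\<^sup>2 * d / M * w / M"
    using M by (intro divide_right_mono) auto
  also have "\<bar>a * M - (real r - 1) * w\<bar> / M = \<bar>(a * M - (real r - 1) * w) / M\<bar>"
    using M by (simp only: abs_divide abs_of_pos)
  also have "(a * M - (real r - 1) * w) / M = a - (real r - 1) / M * w"
    using M by (simp add: field_simps)
  also have "6 * r\<^sup>2 * d / M * w / M \<le> 12 * r\<^sup>2 * d / M\<^sup>2 * w"
  proof -
    have "6 * r\<^sup>2 * d / M * w / M = 6 * (r\<^sup>2 * d / M\<^sup>2 * w)" by (simp add: power2_eq_square)
    also have "\<dots> \<le> 12 * (r\<^sup>2 * d / M\<^sup>2 * w)"
      using M a0 by (intro mult_right_mono) auto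
    finally show ?thesis by simp
  qed
  finally show ?thesis by (simp add: a_def M_def w_def)
qed

end

text \<open>Telescoping product over the pairs of \<open>L\<close>: adding one pair multiplies the
  count by \<open>1 - y\<close> with \<open>y\<close> close to \<open>(r - 1) / card S\<close>, and
  the logarithms of these factors are summed. Positivity is carried along so that each conditional
  probability is defined.\<close>

lemma card_proper_maps:
  fixes S :: "'a set" and C :: "'b set"
  assumes fin: "finite S" "finite C" "finite L"
    and L: "\<And>e. e \<in> L \<Longrightarrow> \<exists>p\<in>S. \<exists>q\<in>S. p \<noteq> q \<and> e = {p, q}"
    and deg: "\<And>u. u \<in> S \<Longrightarrow> card {v \<in> S. {u, v} \<in> L} \<le> d"
    and large: "2 * (r + 2 * r * d + 8) \<le> card S" and r: "r \<ge> 1" and d: "d \<ge> 1"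
    and ne: "balanced_maps S C r \<noteq> {}"
  shows "card (proper_maps S C r L) > 0"
    and "\<bar>ln (card (proper_maps S C r L) / card (balanced_maps S C r))
        + card L * ((real r - 1) / card S)\<bar> \<le> card L * (20 * real r ^ 2 * d / real (card S) ^ 2)"
proof -
  define M where "M = real (card S)"
  have M: "M > 0" using large by (simp add: M_def)
  define B where "B = real (card (balanced_maps S C r))"
  have B: "B > 0"
    using ne finite_balanced_maps[OF fin(1,2)] by (simp add: B_def card_gt_0_iff)
  have "card (proper_maps S C r L) > 0 \<and>
      \<bar>ln (card (proper_maps S C r L) / B) + card L * ((real r - 1) / M)\<bar>
        \<le> card L * (20 * real r ^ 2 * d / M ^ 2)"
    using fin(3) subset_refl
  proof (induction rule: finite_subset_induct')
    case empty
    have "proper_maps S C r {} = balanced_maps S C r" by (simp add: proper_maps_def)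
    then show ?case using B by (simp add: B_def)
  next
    case (insert e E)
    obtain p q where pq: "p \<in> S" "q \<in> S" "p \<noteq> q" "e = {p, q}" using L insert.hyps by blast
    interpret conflict_graph S C r d E
    proof
      fix u assume u: "u \<in> S"
      have "card {v \<in> S. {u, v} \<in> E} \<le> card {v \<in> S. {u, v} \<in> L}"
        using insert.hyps fin by (intro card_mono) auto
      then show "card {v \<in> S. {u, v} \<in> E} \<le> d" using deg[OF u] by simp
    qed (use fin in auto)
    define w where "w = real (card W)"
    define a where "a = real (card {b \<in> W. b q = b p})"
    define y where "y = a / w"
    have w: "w > 0" using insert.IH by (simp add: w_def)
    have new: "real (card (proper_maps S C r (insert e E))) = w - a"
    proof -
      have "proper_maps S C r (insert e E) = W - {b \<in> W. b q = b p}"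
        using pq by (auto simp: proper_maps_def doubleton_eq_iff)
      moreover have "card {b \<in> W. b q = b p} \<le> card W"
        using finite_W by (intro card_mono) auto
      ultimately show ?thesis
        using finite_W by (simp add: card_Diff_subset w_def a_def of_nat_diff)
    qed
    have "a \<le> 2 * r / M * w"
      using coincidence_le[OF large pq(1-3), of "{}" "\<lambda>_. True"]
      by (simp add: a_def w_def M_def)
    then have y: "y \<le> 2 * r / M" "y \<ge> 0" using w by (auto simp: y_def field_simps a_def)
    have "real (2 * (r + 2 * r * d + 8)) \<le> M" using large unfolding M_def by (rule of_nat_mono)
    moreover have "real r \<le> real (r * d)" using d by (intro of_nat_mono) simp
    ultimately have "4 * r \<le> M" by simp
    then have "2 * r / M \<le> 1 / 2" using M by (simp add: field_simps)
    then have y_half: "y \<le> 1 / 2" using y by simp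
    have "\<bar>a - (real r - 1) / M * w\<bar> \<le> 12 * real r ^ 2 * d / M ^ 2 * w"
      using coincidence_sharp[OF large r d pq(1-3)] insert.hyps pq
      by (simp add: a_def w_def M_def)
    then have "\<bar>a - (real r - 1) / M * w\<bar> / w \<le> 12 * real r ^ 2 * d / M ^ 2"
      using w by (simp add: pos_divide_le_eq)
    moreover have "\<bar>a - (real r - 1) / M * w\<bar> / w = \<bar>(a - (real r - 1) / M * w) / w\<bar>"
      using w by (simp only: abs_divide abs_of_pos)
    moreover have "(a - (real r - 1) / M * w) / w = y - (real r - 1) / M"
      using w by (simp add: y_def diff_divide_distrib)
    ultimately have sharp: "\<bar>y - (real r - 1) / M\<bar> \<le> 12 * real r ^ 2 * d / M ^ 2"
      by (simp only:)
    \<comment> \<open>Second-order error of the logarithm, valid for \<open>y \<le> 1 / 2\<close>;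
      squaring the crude bound on \<open>y\<close> gives the constant 8.\<close>
    have "\<bar>ln (1 + - y) - - y\<bar> \<le> 2 * (- y)\<^sup>2"
      using y y_half by (intro abs_ln_one_plus_x_minus_x_bound) auto
    also have "(- y)\<^sup>2 \<le> (2 * r / M)\<^sup>2" using y by (simp only: power2_minus) (intro power_mono)
    also have "2 * (2 * r / M)\<^sup>2 = 8 * (r\<^sup>2 * 1 / M\<^sup>2)" by (simp add: power_divide)
    also have "\<dots> \<le> 8 * (r\<^sup>2 * d / M\<^sup>2)"
      using mult_left_mono[of 1 "real d" "(real r)\<^sup>2"] d
      by (intro mult_left_mono divide_right_mono) auto
    finally have quad: "\<bar>ln (1 - y) + y\<bar> \<le> 8 * (r\<^sup>2 * d / M\<^sup>2)" by simp
    have "w - a = w * (1 - y)" using w by (simp add: y_def field_simps)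
    then have "ln ((w - a) / B) = ln (w / B * (1 - y))" by simp
    also have "\<dots> = ln (w / B) + ln (1 - y)"
      using w B y_half by (intro ln_mult_pos) auto
    finally have ln: "ln ((w - a) / B) = ln (w / B) + ln (1 - y)" .
    have IH: "\<bar>ln (w / B) + card E * ((real r - 1) / M)\<bar>
        \<le> card E * (20 * (r\<^sup>2 * d / M\<^sup>2))"
      using insert.IH by (simp add: w_def mult.assoc)
    have card: "real (card (insert e E)) = card E + 1"
      using insert.hyps by simp
    define A where "A = (real r - 1) / M"
    define D where "D = r\<^sup>2 * d / M\<^sup>2"
    \<comment> \<open>Here 20 = 12 + 8: the error of the coincidence probability plus that of the
      logarithm.\<close>
    have "\<bar>ln ((w - a) / B) + (card E + 1) * A\<bar> \<le> (card E + 1) * (20 * D)"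
    proof -
      have "\<bar>ln (w / B) + card E * A\<bar> \<le> card E * (20 * D)"
        using IH by (simp only: A_def D_def)
      moreover have "\<bar>y - A\<bar> \<le> 12 * D" using sharp by (simp add: A_def D_def)
      moreover have "\<bar>ln (1 - y) + y\<bar> \<le> 8 * D" using quad by (simp only: D_def)
      moreover have "(card E + 1) * A = card E * A + A"
        "(card E + 1) * (20 * D) = card E * (20 * D) + 20 * D" by (simp_all add: algebra_simps)
      ultimately show ?thesis unfolding ln by linarith
    qed
    moreover have "w - a > 0" using w y_half \<open>w - a = w * (1 - y)\<close> by simp
    ultimately show ?case
      using new unfolding card by (simp add: A_def D_def mult.assoc)
  qed
  then show "card (proper_maps S C r L) > 0"
    and "\<bar>ln (card (proper_maps S C r L) / card (balanced_maps S C r))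
        + card L * ((real r - 1) / card S)\<bar> \<le> card L * (20 * real r ^ 2 * d / real (card S) ^ 2)"
    by (simp_all add: B_def M_def)
qed

section \<open>Counting balanced maps\<close>

lemma card_balanced_maps_insert:
  assumes fin: "finite S" "finite C" and c: "c \<notin> C"
  shows "card (balanced_maps S (insert c C) r)
    = (\<Sum>B | B \<subseteq> S \<and> card B = r. card (balanced_maps (S - B) C r))"
proof -
  \<comment> \<open>A balanced map splits into the block of the new label \<open>c\<close> and its
    restriction to the remaining points, which is balanced over \<open>C\<close>.\<close>
  let ?Sig = "SIGMA B:{B. B \<subseteq> S \<and> card B = r}. balanced_maps (S - B) C r"
  let ?f = "\<lambda>(B, b) p. if p \<in> B then c else b p"
  let ?g = "\<lambda>b. ({p \<in> S. b p = c}, restrict b {p \<in> S. b p \<noteq> c})"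
  have "bij_betw ?f ?Sig (balanced_maps S (insert c C) r)"
  proof (rule bij_betw_byWitness[where f' = ?g])
    have "?g (?f (B, b)) = (B, b)" if *: "(B, b) \<in> ?Sig" for B b
    proof -
      have b: "b \<in> (S - B) \<rightarrow>\<^sub>E C" using * by (auto simp: balanced_maps_def)
      then have "{p \<in> S. ?f (B, b) p = c} = B" using * c by auto
      moreover have "{p \<in> S. ?f (B, b) p \<noteq> c} = S - B" using b c by auto
      moreover have "restrict (?f (B, b)) (S - B) = b"
        using b by (auto simp: fun_eq_iff PiE_iff extensional_def)
      ultimately show ?thesis by simp
    qed
    then have "?g (?f (fst x, snd x)) = (fst x, snd x)" if "(fst x, snd x) \<in> ?Sig" for x
      using that .
    then show "\<forall>x\<in>?Sig. ?g (?f x) = x" by (intro ballI) (simp only: prod.collapse)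
    show "\<forall>b\<in>balanced_maps S (insert c C) r. ?f (?g b) = b"
      by (auto simp: balanced_maps_def fun_eq_iff PiE_iff extensional_def)
    show "?f ` ?Sig \<subseteq> balanced_maps S (insert c C) r"
    proof (rule image_subsetI)
      fix x assume "x \<in> ?Sig"
      then obtain B b where x: "x = (B, b)" and B: "B \<subseteq> S" "card B = r"
        and b: "b \<in> balanced_maps (S - B) C r" by auto
      have bC: "b \<in> (S - B) \<rightarrow>\<^sub>E C" using b by (simp add: balanced_maps_def)
      have "{p \<in> S. ?f (B, b) p = c} = B" using B bC c by auto
      moreover have "{p \<in> S. ?f (B, b) p = a} = {p \<in> S - B. b p = a}" if "a \<in> C" for a
        using that c by auto
      moreover have "?f (B, b) \<in> S \<rightarrow>\<^sub>E insert c C"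
        using B bC by (auto simp: PiE_iff extensional_def)
      ultimately have "?f (B, b) \<in> balanced_maps S (insert c C) r"
        using b B by (auto simp: balanced_maps_def)
      then show "?f x \<in> balanced_maps S (insert c C) r" by (simp only: x)
    qed
    show "?g ` balanced_maps S (insert c C) r \<subseteq> ?Sig"
    proof (rule image_subsetI)
      fix b assume b: "b \<in> balanced_maps S (insert c C) r"
      let ?B = "{p \<in> S. b p = c}"
      have "card ?B = r" using b by (simp add: balanced_maps_def)
      moreover have "restrict b {p \<in> S. b p \<noteq> c} \<in> balanced_maps (S - ?B) C r"
      proof -
        have "restrict b {p \<in> S. b p \<noteq> c} \<in> (S - ?B) \<rightarrow>\<^sub>E C"
          using b by (auto simp: balanced_maps_def PiE_iff extensional_def)
        moreover have "{p \<in> S - ?B. restrict b {p \<in> S. b p \<noteq> c} p = a} = {p \<in> S. b p = a}"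
          if "a \<in> C" for a using that c by auto
        ultimately show ?thesis using b by (auto simp: balanced_maps_def)
      qed
      ultimately show "?g b \<in> ?Sig" by (intro SigmaI CollectI conjI) auto
    qed
  qed
  then have "card (balanced_maps S (insert c C) r) = card ?Sig"
    by (simp add: bij_betw_same_card)
  also have "\<dots> = (\<Sum>B | B \<subseteq> S \<and> card B = r. card (balanced_maps (S - B) C r))"
    using fin by (intro card_SigmaI) (auto intro!: finite_balanced_maps)
  finally show ?thesis .
qed

text \<open>This is the multinomial coefficient, written without division. Each induction step
  selects the block of one label and uses \<open>fact r * fact (card S - r) * (card S choose r) =
  fact (card S)\<close>.\<close>

lemma card_balanced_maps:
  fixes S :: "'a set" and C :: "'b set"
  assumes "finite C" "finite S" "card S = r * card C"
  shows "card (balanced_maps S C r) * fact r ^ card C = fact (card S)"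
  using assms
proof (induction C arbitrary: S rule: finite_induct)
  case empty
  then have "balanced_maps S ({} :: 'b set) r = {\<lambda>_. undefined}"
    by (auto simp: balanced_maps_def)
  then show ?case using empty by simp
next
  case (insert c C)
  have le: "r \<le> card S" using insert by simp
  have "card (balanced_maps (S - B) C r) * fact r ^ card C = fact (card S - r)"
    if "B \<subseteq> S" "card B = r" for B
  proof -
    have "card (S - B) = card S - r"
      using that insert.prems by (metis card_Diff_subset finite_subset)
    then show ?thesis using insert.IH[of "S - B"] insert by simp
  qed
  then have "(\<Sum>B | B \<subseteq> S \<and> card B = r. card (balanced_maps (S - B) C r) * fact r ^ card C)
      = (card S choose r) * fact (card S - r)"
    using n_subsets[OF insert.prems(1)] by simp
  then have "card (balanced_maps S (insert c C) r) * fact r ^ card C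
      = (card S choose r) * fact (card S - r)"
    using insert by (simp add: card_balanced_maps_insert sum_distrib_right)
  then have "card (balanced_maps S (insert c C) r) * fact r ^ card (insert c C)
      = fact r * fact (card S - r) * (card S choose r)"
    using insert by (simp add: mult_ac)
  then show ?case using binomial_fact_lemma[OF le] by (simp add: mult_ac)
qed

section \<open>Hypergraphs in the configuration model\<close>

definition points :: "nat \<Rightarrow> (nat \<Rightarrow> nat) \<Rightarrow> (nat \<times> nat) set" where
  "points n k = (SIGMA i:{1..n}. {..<k i})"

text \<open>The conflict graph that is to be separated: a label holding both points of such a pair
  is a loop, that is, an edge with a repeated vertex.\<close>

definition vertex_pairs :: "nat \<Rightarrow> (nat \<Rightarrow> nat) \<Rightarrow> (nat \<times> nat) set set" where
  "vertex_pairs n k = (\<Union>i\<in>{1..n}. {e. e \<subseteq> {i} \<times> {..<k i} \<and> card e = 2})"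

text \<open>Forgetting the copies collapses repeated vertices, so for a balanced map this set has
  \<open>r\<close> elements only if the label holds no loop.\<close>

definition edge_at :: "nat \<Rightarrow> (nat \<Rightarrow> nat) \<Rightarrow> (nat \<times> nat \<Rightarrow> nat) \<Rightarrow> nat \<Rightarrow> nat set" where
  "edge_at n k b c = fst ` {p \<in> points n k. b p = c}"

lemma finite_points [simp]: "finite (points n k)"
  by (simp add: points_def)

lemma card_points: "card (points n k) = M n k"
  by (simp add: points_def M_def)

lemma vertex_pairs_iff:
  "{u, v} \<in> vertex_pairs n k \<longleftrightarrow> u \<in> points n k \<and> v \<in> points n k \<and> fst u = fst v \<and> u \<noteq> v"
  by (cases u; cases v) (auto simp: vertex_pairs_def points_def card_2_iff' card_insert_if)

lemma vertex_pairs_doubleton: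
  assumes "e \<in> vertex_pairs n k"
  shows "\<exists>p\<in>points n k. \<exists>q\<in>points n k. p \<noteq> q \<and> e = {p, q}"
proof -
  obtain p q where "e = {p, q}" "p \<noteq> q"
    using assms by (auto simp: vertex_pairs_def card_2_iff)
  then show ?thesis using assms vertex_pairs_iff[of p q n k] by auto
qed

lemma finite_vertex_pairs: "finite (vertex_pairs n k)"
proof -
  have "vertex_pairs n k \<subseteq> Pow (points n k)" by (auto simp: vertex_pairs_def points_def)
  then show ?thesis by (rule finite_subset) simp
qed

lemma real_choose_two: "real (a choose 2) = falling_factorial (real a) 2 / 2"
  by (simp add: falling_factorial_def numeral_2_eq_2 gbinomial_prod_rev binomial_gbinomial)

lemma card_vertex_pairs: "real (card (vertex_pairs n k)) = M2 n k / 2"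
proof -
  have "card (vertex_pairs n k) = (\<Sum>i=1..n. card {e. e \<subseteq> {i} \<times> {..<k i} \<and> card e = 2})"
    unfolding vertex_pairs_def
  proof (rule card_UN_disjoint)
    show "\<forall>i\<in>{1..n}. finite {e. e \<subseteq> {i} \<times> {..<k i} \<and> card e = 2}" by auto
    show "\<forall>i\<in>{1..n}. \<forall>j\<in>{1..n}. i \<noteq> j \<longrightarrow>
        {e. e \<subseteq> {i} \<times> {..<k i} \<and> card e = 2} \<inter> {e. e \<subseteq> {j} \<times> {..<k j} \<and> card e = 2} = {}"
    proof (intro ballI impI)
      fix i j :: nat assume "i \<noteq> j"
      show "{e. e \<subseteq> {i} \<times> {..<k i} \<and> card e = 2} \<inter> {e. e \<subseteq> {j} \<times> {..<k j} \<and> card e = 2} = {}"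
      proof (rule equals0I, clarify)
        fix e assume "e \<subseteq> {i} \<times> {..<k i}" "e \<subseteq> {j} \<times> {..<k j}" and card: "card e = 2"
        then have "e = {}" using \<open>i \<noteq> j\<close> by blast
        with card show False by simp
      qed
    qed
  qed simp
  also have "\<dots> = (\<Sum>i=1..n. k i choose 2)"
    by (simp add: n_subsets card_cartesian_product)
  finally show ?thesis
    by (simp add: real_choose_two M2_def sum_divide_distrib)
qed

lemma vertex_pairs_degree_le:
  assumes "\<And>i. i \<in> {1..n} \<Longrightarrow> k i \<le> K" "u \<in> points n k"
  shows "card {v \<in> points n k. {u, v} \<in> vertex_pairs n k} \<le> K"
proof -
  have "{v \<in> points n k. {u, v} \<in> vertex_pairs n k} \<subseteq> {fst u} \<times> {..<k (fst u)}"
    by (auto simp: vertex_pairs_iff points_def)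
  then have "card {v \<in> points n k. {u, v} \<in> vertex_pairs n k} \<le> card ({fst u} \<times> {..<k (fst u)})"
    by (intro card_mono) auto
  also have "\<dots> \<le> K" using assms by (auto simp: card_cartesian_product points_def)
  finally show ?thesis .
qed

section \<open>Hypergraphs with prescribed degrees\<close>

lemma finite_hypergraphs: "finite (hypergraphs_with_degrees n r k)"
proof -
  have "hypergraphs_with_degrees n r k \<subseteq> Pow (Pow {1..n})"
    by (auto simp: hypergraphs_with_degrees_def simple_uniform_hypergraphs_def)
  then show ?thesis by (rule finite_subset) simp
qed

lemma hypergraph_edges:
  assumes "H \<in> hypergraphs_with_degrees n r k"
  shows "finite H" "e \<in> H \<Longrightarrow> e \<subseteq> {1..n}" "e \<in> H \<Longrightarrow> card e = r"
    "i \<in> {1..n} \<Longrightarrow> card {e \<in> H. i \<in> e} = k i"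
proof -
  have "H \<subseteq> Pow {1..n}"
    using assms by (auto simp: hypergraphs_with_degrees_def simple_uniform_hypergraphs_def)
  then show "finite H" by (rule finite_subset) simp
qed (use assms in \<open>auto simp: hypergraphs_with_degrees_def simple_uniform_hypergraphs_def
  hdegree_def\<close>)

lemma handshake:
  assumes "H \<in> hypergraphs_with_degrees n r k"
  shows "M n k = r * card H"
proof -
  note H = hypergraph_edges[OF assms]
  have "M n k = (\<Sum>i=1..n. \<Sum>e\<in>H. if i \<in> e then 1 else 0)"
    using H(1,4) by (simp add: M_def sum.If_cases Int_def)
  also have "\<dots> = (\<Sum>e\<in>H. \<Sum>i=1..n. if i \<in> e then 1 else 0)" by (rule sum.swap)
  also have "\<dots> = (\<Sum>e\<in>H. r)"
  proof (rule sum.cong)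
    fix e assume e: "e \<in> H"
    have "{1..n} \<inter> {i. i \<in> e} = e" using H(2)[OF e] by auto
    then show "(\<Sum>i=1..n. if i \<in> e then 1 else 0) = r"
      using H(3)[OF e] by (simp add: sum.If_cases)
  qed simp
  finally show ?thesis by simp
qed

section \<open>Correspondence between simple configurations and labelled hypergraphs\<close>

abbreviation loopless_maps :: "nat \<Rightarrow> nat \<Rightarrow> (nat \<Rightarrow> nat) \<Rightarrow> nat \<Rightarrow> (nat \<times> nat \<Rightarrow> nat) set" where
  "loopless_maps n r k m \<equiv> proper_maps (points n k) {..<m} r (vertex_pairs n k)"

text \<open>Injectivity of \<open>edge_at\<close> on the labels excludes repeated edges. The set
  \<open>X\<close> of forbidden edges will be the given hypergraph for one count and empty for the
  other.\<close>

definition simple_maps ::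
  "nat \<Rightarrow> nat \<Rightarrow> (nat \<Rightarrow> nat) \<Rightarrow> nat \<Rightarrow> nat set set \<Rightarrow> (nat \<times> nat \<Rightarrow> nat) set" where
  "simple_maps n r k m X = {b \<in> loopless_maps n r k m.
     inj_on (edge_at n k b) {..<m} \<and> edge_at n k b ` {..<m} \<inter> X = {}}"

lemma mem_edge_at: "i \<in> edge_at n k b c \<longleftrightarrow> i \<in> {1..n} \<and> (\<exists>j<k i. b (i, j) = c)"
  unfolding edge_at_def points_def by (auto simp: image_iff) 

lemma loopless_maps_inj:
  assumes "b \<in> loopless_maps n r k m" "i \<in> {1..n}"
  shows "inj_on (\<lambda>j. b (i, j)) {..<k i}"
proof (rule inj_onI)
  fix j j' assume *: "j \<in> {..<k i}" "j' \<in> {..<k i}" "b (i, j) = b (i, j')"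
  then have p: "(i, j) \<in> points n k" "(i, j') \<in> points n k" using assms(2) by (auto simp: points_def)
  show "j = j'"
  proof (rule ccontr)
    assume "j \<noteq> j'"
    then have "{(i, j), (i, j')} \<in> vertex_pairs n k" using p by (simp add: vertex_pairs_iff)
    then show False using assms(1) p *(3) by (simp add: proper_maps_def)
  qed
qed

lemma loopless_maps_inj_fst:
  assumes "b \<in> loopless_maps n r k m"
  shows "inj_on fst {p \<in> points n k. b p = c}"
proof (rule inj_onI, clarsimp)
  fix i j j' assume "(i, j) \<in> points n k" "(i, j') \<in> points n k" "b (i, j') = b (i, j)"
  then show "j = j'"
    using inj_onD[OF loopless_maps_inj[OF assms, of i], of j j'] by (auto simp: points_def)
qed

lemma card_edge_at:
  assumes "b \<in> loopless_maps n r k m" "c < m"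
  shows "card (edge_at n k b c) = r"
  using card_image[OF loopless_maps_inj_fst[OF assms(1), of c]] assms
  by (simp add: edge_at_def proper_maps_def balanced_maps_def)

lemma loopless_maps_label:
  assumes "b \<in> loopless_maps n r k m" "i \<in> {1..n}" "j < k i"
  shows "b (i, j) < m"
  using assms by (auto simp: proper_maps_def balanced_maps_def points_def)

lemma card_inj_PiE:
  assumes "finite A" "finite B" "card A = card B"
  shows "card {f \<in> A \<rightarrow>\<^sub>E B. inj_on f A} = fact (card A)"
  using card_inj_on_subset_funcset[of A B A] assms by (simp add: fact_prod_rev)

lemma inj_PiE_surj:
  assumes "f \<in> A \<rightarrow>\<^sub>E B" "inj_on f A" "finite A" "finite B" "card A = card B"
  shows "f ` A = B"
  using assms by (intro card_subset_eq) (auto simp: card_image)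

text \<open>
  The triple consists of the hypergraph, the labelling of its edges, and for each vertex the order
  in which its points are attached to the edges at this vertex.
\<close>

definition labelled_hypergraphs where
  "labelled_hypergraphs n r k m X =
     (SIGMA H:{H \<in> hypergraphs_with_degrees n r k. H \<inter> X = {}}.
        {f \<in> {..<m} \<rightarrow>\<^sub>E H. inj_on f {..<m}} \<times>
        (\<Pi>\<^sub>E i\<in>{1..n}. {g \<in> {..<k i} \<rightarrow>\<^sub>E {e \<in> H. i \<in> e}. inj_on g {..<k i}}))"

text \<open>By the handshake identity \<open>card H = m\<close>, and vertex \<open>i\<close> lies in
  exactly \<open>k i\<close> edges, so all injections counted here are bijections. Hence the number
  of labellings does not depend on \<open>H\<close>.\<close>

lemma card_labelled_hypergraphs:
  assumes M: "M n k = r * m" and r: "r \<ge> 1"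
  shows "card (labelled_hypergraphs n r k m X)
    = fact m * (\<Prod>i=1..n. fact (k i)) * card {H \<in> hypergraphs_with_degrees n r k. H \<inter> X = {}}"
proof -
  have "card ({f \<in> {..<m} \<rightarrow>\<^sub>E H. inj_on f {..<m}} \<times>
        (\<Pi>\<^sub>E i\<in>{1..n}. {g \<in> {..<k i} \<rightarrow>\<^sub>E {e \<in> H. i \<in> e}. inj_on g {..<k i}}))
      = fact m * (\<Prod>i=1..n. fact (k i))" (is "card (?F H \<times> ?G H) = _")
    if H: "H \<in> hypergraphs_with_degrees n r k" for H
  proof -
    note e = hypergraph_edges[OF H]
    have "card H = m" using handshake[OF H] M r by simp
    then have "card (?F H) = fact m" using e(1) by (subst card_inj_PiE) auto
    moreover have "card (?G H) = (\<Prod>i=1..n. fact (k i))"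
      using e(1,4) by (simp add: card_PiE card_inj_PiE)
    ultimately show ?thesis by (simp add: card_cartesian_product)
  qed
  moreover have "finite (?F H \<times> ?G H)" if H: "H \<in> hypergraphs_with_degrees n r k" for H
    using hypergraph_edges(1)[OF H] by (simp add: finite_PiE)
  ultimately show ?thesis
    unfolding labelled_hypergraphs_def by (subst card_SigmaI) (auto simp: finite_hypergraphs)
qed

text \<open>The copies of a vertex carry distinct labels, and distinct labels induce distinct edges;
  hence the copies of \<open>i\<close> enumerate the edges at \<open>i\<close> without repetition,
  and the numbering of the edges recovers the labels.\<close>

lemma bij_betw_simple_maps:
  assumes M: "M n k = r * m" and r: "r \<ge> 1"
  shows "bij_betw (\<lambda>b. (edge_at n k b ` {..<m}, restrict (edge_at n k b) {..<m},
        \<lambda>i\<in>{1..n}. \<lambda>j\<in>{..<k i}. edge_at n k b (b (i, j))))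
      (simple_maps n r k m X) (labelled_hypergraphs n r k m X)"
    (is "bij_betw ?\<Phi> ?A ?T")
proof -
  \<comment> \<open>The label of the point \<open>(i, j)\<close> is the number that the edge
    \<open>g i j\<close> has under the labelling \<open>f\<close>.\<close>
  let ?\<Psi> = "\<lambda>(H, f, g). \<lambda>(i, j)\<in>points n k. inv_into {..<m} f (g i j)"
  have 1: "?\<Phi> b \<in> ?T \<and> ?\<Psi> (?\<Phi> b) = b" if b: "b \<in> ?A" for b
  proof -
    let ?e = "edge_at n k b"
    let ?H = "?e ` {..<m}"
    have bL: "b \<in> loopless_maps n r k m" and inj: "inj_on ?e {..<m}" and X: "?H \<inter> X = {}"
      using b by (auto simp: simple_maps_def)
    have lab: "b (i, j) < m" if "i \<in> {1..n}" "j < k i" for i j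
      using loopless_maps_label[OF bL that] .
    have at: "{e \<in> ?H. i \<in> e} = (\<lambda>j. ?e (b (i, j))) ` {..<k i}" if i: "i \<in> {1..n}" for i
      using lab[OF i] i by (auto simp: mem_edge_at)
    have at_inj: "inj_on (\<lambda>j. ?e (b (i, j))) {..<k i}" if i: "i \<in> {1..n}" for i
    proof (rule inj_onI)
      fix j j' assume *: "j \<in> {..<k i}" "j' \<in> {..<k i}" "?e (b (i, j)) = ?e (b (i, j'))"
      then have "b (i, j) = b (i, j')" using lab[OF i] inj by (auto dest: inj_onD)
      then show "j = j'" using inj_onD[OF loopless_maps_inj[OF bL i]] * by simp
    qed
    have "?H \<in> {H \<in> hypergraphs_with_degrees n r k. H \<inter> X = {}}"
    proof -
      have "e \<subseteq> {1..n} \<and> card e = r" if "e \<in> ?H" for e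
        using that card_edge_at[OF bL] by (auto simp: mem_edge_at)
      moreover have "card {e \<in> ?H. i \<in> e} = k i" if i: "i \<in> {1..n}" for i
        using card_image[OF at_inj[OF i]] by (simp only: at[OF i] card_lessThan)
      ultimately show ?thesis
        using X by (auto simp: hypergraphs_with_degrees_def simple_uniform_hypergraphs_def hdegree_def)
    qed
    moreover have "restrict ?e {..<m} \<in> {f \<in> {..<m} \<rightarrow>\<^sub>E ?H. inj_on f {..<m}}"
      using inj by (auto simp: inj_on_def)
    moreover have "(\<lambda>i\<in>{1..n}. \<lambda>j\<in>{..<k i}. ?e (b (i, j)))
        \<in> (\<Pi>\<^sub>E i\<in>{1..n}. {g \<in> {..<k i} \<rightarrow>\<^sub>E {e \<in> ?H. i \<in> e}. inj_on g {..<k i}})"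
    proof (rule restrict_PiE_iff[THEN iffD2], rule ballI)
      fix i assume i: "i \<in> {1..n}"
      have "(\<lambda>j\<in>{..<k i}. ?e (b (i, j))) \<in> {..<k i} \<rightarrow>\<^sub>E {e \<in> ?H. i \<in> e}"
        unfolding at[OF i] by auto
      moreover have "inj_on (\<lambda>j\<in>{..<k i}. ?e (b (i, j))) {..<k i}"
        using at_inj[OF i] by (auto simp: inj_on_def)
      ultimately show "(\<lambda>j\<in>{..<k i}. ?e (b (i, j)))
          \<in> {g \<in> {..<k i} \<rightarrow>\<^sub>E {e \<in> ?H. i \<in> e}. inj_on g {..<k i}}" by blast
    qed
    ultimately have "?\<Phi> b \<in> ?T"
      unfolding labelled_hypergraphs_def mem_Sigma_iff mem_Times_iff fst_conv snd_conv
      by (intro conjI)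
    moreover have "?\<Psi> (?\<Phi> b) = b"
    proof
      fix p :: "nat \<times> nat"
      obtain i j where p: "p = (i, j)" by force
      have "inj_on (restrict ?e {..<m}) {..<m}" using inj by (auto simp: inj_on_def)
      then have *: "inv_into {..<m} (restrict ?e {..<m}) (?e c) = c" if "c < m" for c
        using inv_into_f_f[of "restrict ?e {..<m}" "{..<m}" c] that by simp
      show "?\<Psi> (?\<Phi> b) p = b p"
      proof (cases "p \<in> points n k")
        case True
        then have "i \<in> {1..n}" "j < k i" by (auto simp: p points_def)
        then show ?thesis using True *[OF lab] by (simp add: p)
      next
        case False
        then show ?thesis
          using bL by (auto simp: p proper_maps_def balanced_maps_def PiE_iff extensional_def)
      qed
    qed
    ultimately show ?thesis ..
  qed
  have 2: "?\<Psi> x \<in> ?A \<and> ?\<Phi> (?\<Psi> x) = x" if x: "x \<in> ?T" for x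
  proof -
    obtain H f g where xe: "x = (H, f, g)" by (cases x) auto
    have H: "H \<in> hypergraphs_with_degrees n r k" "H \<inter> X = {}"
      and f: "f \<in> {..<m} \<rightarrow>\<^sub>E H" "inj_on f {..<m}"
      and g: "g \<in> (\<Pi>\<^sub>E i\<in>{1..n}. {g \<in> {..<k i} \<rightarrow>\<^sub>E {e \<in> H. i \<in> e}. inj_on g {..<k i}})"
      using x by (auto simp: xe labelled_hypergraphs_def)
    note e = hypergraph_edges[OF H(1)]
    have "card H = m" using handshake[OF H(1)] M r by simp
    \<comment> \<open>Equal cardinalities make \<open>f\<close> surjective, so
      \<open>inv_into\<close> is a genuine two-sided inverse on \<open>H\<close>; the same argument
      for each \<open>g i\<close> gives \<open>gH\<close>.\<close>
    then have fH: "f ` {..<m} = H" using f e(1) by (intro inj_PiE_surj) auto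
    have gi: "g i \<in> {..<k i} \<rightarrow>\<^sub>E {e \<in> H. i \<in> e}" "inj_on (g i) {..<k i}" if "i \<in> {1..n}" for i
      using PiE_mem[OF g that] by auto
    have gH: "g i ` {..<k i} = {e \<in> H. i \<in> e}" if "i \<in> {1..n}" for i
      using gi[OF that] e(1) e(4)[OF that] by (intro inj_PiE_surj) auto
    have gin: "g i j \<in> H" if "i \<in> {1..n}" "j < k i" for i j
      using gH[OF that(1)] that(2) by blast
    define b where "b = ?\<Psi> (H, f, g)"
    have b: "b (i, j) = inv_into {..<m} f (g i j)" if "i \<in> {1..n}" "j < k i" for i j
      using that by (simp add: b_def points_def)
    have fb: "f (b (i, j)) = g i j" if "i \<in> {1..n}" "j < k i" for i j
      using f_inv_into_f[of "g i j" f "{..<m}"] gin[OF that] b[OF that] by (simp add: fH)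
    have bm: "b (i, j) < m" if "i \<in> {1..n}" "j < k i" for i j
      using inv_into_into[of "g i j" f "{..<m}"] gin[OF that] b[OF that] by (simp add: fH)
    have b_iff: "b (i, j) = c \<longleftrightarrow> g i j = f c" if "i \<in> {1..n}" "j < k i" "c < m" for i j c
      using fb[OF that(1,2)] bm[OF that(1,2)] that(3) f(2) by (auto dest: inj_onD)
    \<comment> \<open>Surjectivity of \<open>g i\<close> onto the edges at \<open>i\<close> is what
      puts every vertex of \<open>f c\<close> back into the recovered edge.\<close>
    have edge: "edge_at n k b c = f c" if c: "c < m" for c
    proof -
      have fc: "f c \<in> H" using f(1) c by auto
      have "i \<in> edge_at n k b c \<longleftrightarrow> i \<in> f c" for i
      proof (cases "i \<in> {1..n}")
        case True
        then have "i \<in> edge_at n k b c \<longleftrightarrow> (\<exists>j<k i. g i j = f c)"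
          unfolding mem_edge_at using b_iff[OF True _ c] by blast
        also have "\<dots> \<longleftrightarrow> f c \<in> g i ` {..<k i}" by auto
        also have "\<dots> \<longleftrightarrow> i \<in> f c" using fc by (simp add: gH[OF True])
        finally show ?thesis .
      next
        case False
        then show ?thesis using e(2)[OF fc] by (auto simp: mem_edge_at)
      qed
      then show ?thesis by blast
    qed
    have proper: "b p \<noteq> b q" if e: "p \<in> points n k" "q \<in> points n k" "{p, q} \<in> vertex_pairs n k" for p q
    proof -
      obtain i j j' where pq: "p = (i, j)" "q = (i, j')" "j \<noteq> j'" "i \<in> {1..n}" "j < k i" "j' < k i"
        using e by (cases p; cases q) (auto simp: vertex_pairs_iff points_def)
      then have "g i j \<noteq> g i j'" using gi(2)[of i] by (auto dest: inj_onD)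
      then show ?thesis using fb[of i j] fb[of i j'] pq by auto
    qed
    have injfst: "inj_on fst {p \<in> points n k. b p = c}" for c
    proof (rule inj_onI, clarsimp)
      fix i j j' assume *: "(i, j) \<in> points n k" "(i, j') \<in> points n k" "b (i, j') = b (i, j)"
      then show "j = j'"
        using proper[of "(i, j)" "(i, j')"] by (auto simp: vertex_pairs_iff)
    qed
    have "b \<in> points n k \<rightarrow>\<^sub>E {..<m}"
    proof (rule PiE_I)
      fix p assume "p \<in> points n k" then show "b p \<in> {..<m}" using bm by (auto simp: points_def)
    next
      fix p assume "p \<notin> points n k" then show "b p = undefined"
        unfolding b_def by (simp only: prod.case restrict_apply if_False)
    qed
    moreover have "card {p \<in> points n k. b p = c} = r" if c: "c < m" for c
    proof -
      have "card {p \<in> points n k. b p = c} = card (edge_at n k b c)"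
        unfolding edge_at_def by (rule card_image[OF injfst, symmetric])
      also have "\<dots> = r" using edge[OF c] e(3)[of "f c"] f(1) c by auto
      finally show ?thesis .
    qed
    ultimately have bL: "b \<in> loopless_maps n r k m"
      unfolding proper_maps_def balanced_maps_def using proper by blast
    have img: "edge_at n k b ` {..<m} = H" using fH edge by (auto simp: image_iff)
    have "inj_on (edge_at n k b) {..<m}" using f(2) edge by (auto simp: inj_on_def)
    then have "b \<in> ?A" using bL H(2) img by (simp add: simple_maps_def)
    moreover have "restrict (edge_at n k b) {..<m} = f"
      using f(1) edge by (auto simp: fun_eq_iff PiE_iff extensional_def)
    moreover have "(\<lambda>i\<in>{1..n}. \<lambda>j\<in>{..<k i}. edge_at n k b (b (i, j))) = g"
    proof
      fix i
      show "(\<lambda>i\<in>{1..n}. \<lambda>j\<in>{..<k i}. edge_at n k b (b (i, j))) i = g i"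
      proof (cases "i \<in> {1..n}")
        case True
        have "(if j \<in> {..<k i} then edge_at n k b (b (i, j)) else undefined) = g i j" for j
          using edge bm[OF True] fb[OF True] gi(1)[OF True]
          by (auto simp: PiE_iff extensional_def)
        then show ?thesis using True by (simp add: fun_eq_iff)
      next
        case False
        then show ?thesis using g by (auto simp: PiE_iff extensional_def)
      qed
    qed
    ultimately have "b \<in> ?A \<and> ?\<Phi> b = x" using img xe by (simp only: simp_thms)
    then show ?thesis by (simp only: b_def xe)
  qed
  show ?thesis
    by (rule bij_betw_byWitness[where f' = ?\<Psi>])
      (intro ballI conjunct2[OF 1] conjunct2[OF 2] image_subsetI conjunct1[OF 1] conjunct1[OF 2];
        assumption)+
qed

lemma card_simple_maps:
  assumes "M n k = r * m" "r \<ge> 1"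
  shows "card (simple_maps n r k m X)
    = fact m * (\<Prod>i=1..n. fact (k i)) * card {H \<in> hypergraphs_with_degrees n r k. H \<inter> X = {}}"
  using bij_betw_same_card[OF bij_betw_simple_maps[OF assms]] card_labelled_hypergraphs[OF assms]
  by simp

section \<open>Hypergraphs with sparse degrees\<close>

text \<open>\<open>K\<close> is only an upper bound on the degrees, so that one value serves both
  for k and for k - x. The hypothesis \<open>sparse\<close> says that the first term of \<beta> is
  at most 1 and supplies \<open>large\<close>.\<close>

locale sparse_degrees =
  fixes n r m K :: nat and k :: "nat \<Rightarrow> nat"
  assumes k_le: "\<And>i. i \<in> {1..n} \<Longrightarrow> k i \<le> K"
    and r_ge: "r \<ge> 3" and M_eq: "M n k = r * m" and M_pos: "M n k > 0"
    and sparse: "r ^ 4 * K ^ 3 \<le> M n k"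
begin

lemma K_pos: "K \<ge> 1"
proof (rule ccontr)
  assume "\<not> K \<ge> 1"
  then have "k i = 0" if "i \<in> {1..n}" for i using k_le[OF that] by simp
  then have "M n k = 0" by (simp add: M_def)
  then show False using M_pos by simp
qed

lemma large: "2 * (r + 2 * r * K + 8) \<le> card (points n k)"
proof -
  have "3 * 1 \<le> r * K" using r_ge K_pos by (rule mult_le_mono)
  moreover have "r \<le> r * K" using K_pos by simp
  moreover have "2 * (r + 2 * r * K + 8) = 2 * r + 4 * (r * K) + 16" by simp
  moreover have "3 ^ 3 * (r * K) = 27 * (r * K)" by simp
  ultimately have "2 * (r + 2 * r * K + 8) \<le> 3 ^ 3 * (r * K)" by linarith
  also have "\<dots> \<le> r ^ 3 * (r * K)" using r_ge by (intro mult_le_mono1 power_mono) auto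
  also have "\<dots> = r ^ 4 * K ^ 1" by (simp add: power4_eq_xxxx power3_eq_cube)
  also have "\<dots> \<le> r ^ 4 * K ^ 3" using K_pos by (intro mult_le_mono2 power_increasing) auto
  finally show ?thesis using sparse by (simp add: card_points)
qed

sublocale conflict_graph "points n k" "{..<m}" r K "vertex_pairs n k"
  by unfold_locales (use k_le in \<open>auto intro: vertex_pairs_degree_le\<close>)

section \<open>Forbidden and repeated edges\<close>

lemma fresh_pairs_star:
  assumes "distinct (a0 # as)" "\<And>a. a \<in> set (a0 # as) \<Longrightarrow> (a, g a) \<in> points n k"
  shows "fresh_pairs (map (\<lambda>a. ((a, g a), (a0, g a0))) as)"
  using assms by (induction as) auto

text \<open>One copy of each vertex of \<open>A\<close> is chosen, in at most
  \<open>K ^ Suc j\<close> ways. The chosen copies share a label if each of the others agrees with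
  the first: \<open>j\<close> coincidences arranged in a star.\<close>

lemma common_edge_le:
  assumes A: "finite A" "card A = Suc j" "A \<subseteq> {1..n}" and j: "j \<le> 5"
  shows "real (card {b \<in> W. \<exists>c. A \<subseteq> edge_at n k b c})
    \<le> K ^ Suc j * (2 * r / M n k) ^ j * card W"
proof -
  obtain as0 where as0: "set as0 = A" "distinct as0" using finite_distinct_list[OF A(1)] by blast
  then have "length as0 = Suc j" using A(2) distinct_card[OF as0(2)] by simp
  then obtain a0 as where as: "as0 = a0 # as" "length as = j" by (auto simp: length_Suc_conv)
  let ?G = "\<Pi>\<^sub>E a\<in>A. {..<k a}"
  let ?l = "\<lambda>g. map (\<lambda>a. ((a, g a), (a0, g a0))) as"
  let ?B = "\<lambda>g. {b \<in> W. \<forall>(q, p)\<in>set (?l g). b q = b p}"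
  have finG: "finite ?G" using A(1) by (intro finite_PiE) auto
  have "{b \<in> W. \<exists>c. A \<subseteq> edge_at n k b c} \<subseteq> (\<Union>g\<in>?G. ?B g)"
  proof clarify
    fix b c assume b: "b \<in> W" and Ac: "A \<subseteq> edge_at n k b c"
    have "\<forall>a\<in>A. \<exists>j. j < k a \<and> b (a, j) = c" using Ac by (auto simp: mem_edge_at)
    then obtain g where g: "\<forall>a\<in>A. g a < k a \<and> b (a, g a) = c" by (rule bchoice[THEN exE])
    let ?g = "restrict g A"
    have "?g \<in> ?G" using g by auto
    moreover have "b \<in> ?B ?g" using b g as0 as by auto
    ultimately show "b \<in> (\<Union>g\<in>?G. ?B g)" by blast
  qed
  then have "card {b \<in> W. \<exists>c. A \<subseteq> edge_at n k b c} \<le> card (\<Union>g\<in>?G. ?B g)"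
    using finG finite_W by (intro card_mono) auto
  also have "\<dots> \<le> (\<Sum>g\<in>?G. card (?B g))" using finG by (rule card_UN_le)
  finally have "real (card {b \<in> W. \<exists>c. A \<subseteq> edge_at n k b c}) \<le> real (\<Sum>g\<in>?G. card (?B g))"
    by (rule of_nat_mono)
  also have "\<dots> = (\<Sum>g\<in>?G. real (card (?B g)))" by (rule of_nat_sum)
  also have "\<dots> \<le> (\<Sum>g\<in>?G. (2 * r / M n k) ^ j * card W)"
  proof (rule sum_mono)
    fix g assume g: "g \<in> ?G"
    have "(a, g a) \<in> points n k" if "a \<in> set (a0 # as)" for a
      using that g as0(1) A(3) by (auto simp: points_def as(1) PiE_iff)
    then have "fresh_pairs (?l g)" using as0(2) by (intro fresh_pairs_star) (auto simp: as(1))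
    then show "real (card (?B g)) \<le> (2 * r / M n k) ^ j * card W"
      using coincidences_le[OF large, of "?l g"] as(2) j by (simp add: card_points)
  qed
  also have "\<dots> = real (card ?G) * ((2 * r / M n k) ^ j * card W)" by simp
  also have "\<dots> \<le> real (K ^ Suc j) * ((2 * r / M n k) ^ j * card W)"
  proof (intro mult_right_mono of_nat_mono)
    have "card ?G = (\<Prod>a\<in>A. k a)" using A(1) by (simp add: card_PiE)
    also have "\<dots> \<le> (\<Prod>a\<in>A. K)" using k_le A(3) by (intro prod_mono) auto
    finally show "card ?G \<le> K ^ Suc j" using A(2) by simp
  qed simp
  finally show ?thesis by (simp only: of_nat_power mult.assoc)
qed

text \<open>
  Only \<open>min r 4\<close> vertices of an edge are used: three of them would cost a factor \<open>r\<^sup>2\<close>, which is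
  bounded when \<open>r = 3\<close>; for \<open>r \<ge> 4\<close> a fourth vertex gains \<open>r K / M\<close>.
\<close>

lemma forbidden_edge_le:
  assumes X: "finite X" "\<And>e. e \<in> X \<Longrightarrow> e \<subseteq> {1..n} \<and> card e = r"
  shows "real (card {b \<in> W. \<exists>c<m. edge_at n k b c \<in> X})
    \<le> 36 * (card X * K ^ 3 / real (M n k) ^ 2) * card W"
proof -
  let ?M = "real (M n k)"
  define j :: nat where "j = (if r = 3 then 2 else 3)"
  have j: "j \<le> 5" "Suc j \<le> r" using r_ge by (auto simp: j_def)
  \<comment> \<open>The constant 36 is \<open>(2 * r) ^ 2\<close> at \<open>r = 3\<close>. For
    larger \<open>r\<close> the constant is 8, and the additional factor
    \<open>r ^ 3 * K / M n k\<close> is at most 1 by \<open>sparse\<close>.\<close>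
  have const: "K ^ Suc j * (2 * r / ?M) ^ j \<le> 36 * (K ^ 3 / ?M ^ 2)"
  proof (cases "r = 3")
    case True
    then show ?thesis by (simp add: j_def power_divide eval_nat_numeral algebra_simps)
  next
    case False
    have "r ^ 3 * K \<le> r ^ 4 * K ^ 3"
      using r_ge K_pos by (intro mult_le_mono power_increasing self_le_power) auto
    then have "real (r ^ 3 * K) \<le> ?M" using sparse by (intro of_nat_mono) simp
    then have le1: "real (r ^ 3 * K) / ?M \<le> 1" using M_pos by simp
    have "K ^ Suc j * (2 * r / ?M) ^ j = 8 * (K ^ 3 / ?M ^ 2) * (real (r ^ 3 * K) / ?M)"
      using False by (simp add: j_def power_divide power_mult_distrib eval_nat_numeral mult_ac)
    also have "\<dots> \<le> 8 * (K ^ 3 / ?M ^ 2) * 1" using le1 by (intro mult_left_mono) auto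
    also have "\<dots> \<le> 36 * (K ^ 3 / ?M ^ 2)" by simp (intro divide_right_mono; simp)
    finally show ?thesis .
  qed
  have "card {b \<in> W. \<exists>c<m. edge_at n k b c \<in> X}
      \<le> card (\<Union>e\<in>X. {b \<in> W. \<exists>c<m. edge_at n k b c = e})"
    using X(1) finite_W by (intro card_mono) auto
  also have "\<dots> \<le> (\<Sum>e\<in>X. card {b \<in> W. \<exists>c<m. edge_at n k b c = e})"
    using X(1) by (rule card_UN_le)
  finally have "real (card {b \<in> W. \<exists>c<m. edge_at n k b c \<in> X})
      \<le> real (\<Sum>e\<in>X. card {b \<in> W. \<exists>c<m. edge_at n k b c = e})" by (rule of_nat_mono)
  also have "\<dots> = (\<Sum>e\<in>X. real (card {b \<in> W. \<exists>c<m. edge_at n k b c = e}))" by (rule of_nat_sum)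
  also have "\<dots> \<le> (\<Sum>e\<in>X. 36 * (K ^ 3 / ?M ^ 2) * card W)"
  proof (rule sum_mono)
    fix e assume e: "e \<in> X"
    obtain A where A: "A \<subseteq> e" "card A = Suc j" "finite A"
      using obtain_subset_with_card_n[of "Suc j" e] X(2)[OF e] j by auto
    have "card {b \<in> W. \<exists>c<m. edge_at n k b c = e} \<le> card {b \<in> W. \<exists>c. A \<subseteq> edge_at n k b c}"
      using A finite_W by (intro card_mono) auto
    then have "real (card {b \<in> W. \<exists>c<m. edge_at n k b c = e})
        \<le> real (card {b \<in> W. \<exists>c. A \<subseteq> edge_at n k b c})" by (rule of_nat_mono)
    also have "\<dots> \<le> K ^ Suc j * (2 * r / M n k) ^ j * card W"
      using A X(2)[OF e] j by (intro common_edge_le) auto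
    also have "\<dots> \<le> 36 * (K ^ 3 / ?M ^ 2) * card W"
      using const by (rule mult_right_mono) simp
    finally show "real (card {b \<in> W. \<exists>c<m. edge_at n k b c = e})
        \<le> 36 * (K ^ 3 / ?M ^ 2) * card W" .
  qed
  also have "\<dots> = 36 * (card X * K ^ 3 / ?M ^ 2) * card W" by simp
  finally show ?thesis .
qed

text \<open>Two equal edges share three vertices, as \<open>r \<ge> 3\<close>. Each of these has one
  copy in either label, which leaves at most \<open>(M n k * K) ^ 3\<close> choices of three pairs
  of copies. Tying together the three copies on each side takes four coincidences, at the cost
  \<open>(2 * r / M n k) ^ 4\<close>.\<close>

lemma repeated_edge_le:
  "real (card {b \<in> W. \<exists>c<m. \<exists>c'<m. c \<noteq> c' \<and> edge_at n k b c = edge_at n k b c'})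
    \<le> 16 * (r ^ 4 * K ^ 3 / M n k) * card W"
    (is "real (card ?R) \<le> _")
proof -
  let ?M = "real (M n k)"
  let ?P = "SIGMA p:points n k. {fst p} \<times> {..<k (fst p)}"
  let ?l = "\<lambda>((p1, q1), (p2, q2), (p3, q3)). [(p3, p1), (p2, p1), (q3, q1), (q2, q1)]"
  let ?T = "{x \<in> ?P \<times> ?P \<times> ?P. fresh_pairs (?l x)}"
  let ?B = "\<lambda>x. {b \<in> W. \<forall>(q, p)\<in>set (?l x). b q = b p}"
  have finP: "finite ?P" by simp
  then have finT: "finite ?T" by simp
  have "?R \<subseteq> (\<Union>x\<in>?T. ?B x)"
  proof clarify
    fix b c c' assume b: "b \<in> W" and c: "c < m" "c' < m" "c \<noteq> c'"
      and eq: "edge_at n k b c = edge_at n k b c'"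
    have "3 \<le> card (edge_at n k b c)" using r_ge by (simp only: card_edge_at[OF b c(1)])
    then obtain A where A: "A \<subseteq> edge_at n k b c" "card A = 3"
      by (rule obtain_subset_with_card_n)
    then obtain a1 a2 a3 where a: "A = {a1, a2, a3}" "a1 \<noteq> a2" "a2 \<noteq> a3" "a1 \<noteq> a3"
      by (auto simp: card_3_iff)
    have n: "a1 \<in> {1..n}" "a2 \<in> {1..n}" "a3 \<in> {1..n}"
      using A a by (auto simp: mem_edge_at)
    obtain j1 j2 j3 where j: "j1 < k a1" "j2 < k a2" "j3 < k a3"
      "b (a1, j1) = c" "b (a2, j2) = c" "b (a3, j3) = c"
      using A(1) unfolding a(1) by (auto simp: mem_edge_at)
    obtain i1 i2 i3 where i: "i1 < k a1" "i2 < k a2" "i3 < k a3"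
      "b (a1, i1) = c'" "b (a2, i2) = c'" "b (a3, i3) = c'"
      using A(1) unfolding a(1) eq by (auto simp: mem_edge_at)
    let ?x = "(((a1, j1), (a1, i1)), ((a2, j2), (a2, i2)), ((a3, j3), (a3, i3)))"
    have ji: "j1 \<noteq> i1" "j2 \<noteq> i2" "j3 \<noteq> i3" using j i c(3) by auto
    have "(a1, j1) \<in> points n k" "(a2, j2) \<in> points n k" "(a3, j3) \<in> points n k"
      "(a1, i1) \<in> points n k" "(a2, i2) \<in> points n k" "(a3, i3) \<in> points n k"
      using n j(1-3) i(1-3) by (simp_all add: points_def)
    then have "?x \<in> ?T" using j(1-3) i(1-3) a(2-4) ji by simp
    moreover have "b \<in> ?B ?x" using b j i by simp
    ultimately show "b \<in> (\<Union>x\<in>?T. ?B x)" by (rule UN_I)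
  qed
  then have "card ?R \<le> card (\<Union>x\<in>?T. ?B x)"
    by (rule card_mono[rotated]) (use finT finite_W in auto)
  also have "\<dots> \<le> (\<Sum>x\<in>?T. card (?B x))" using finT by (rule card_UN_le)
  finally have "real (card ?R) \<le> real (\<Sum>x\<in>?T. card (?B x))" by (rule of_nat_mono)
  also have "\<dots> = (\<Sum>x\<in>?T. real (card (?B x)))" by (rule of_nat_sum)
  also have "\<dots> \<le> (\<Sum>x\<in>?T. (2 * r / ?M) ^ 4 * card W)"
  proof (rule sum_mono)
    fix x assume x: "x \<in> ?T"
    have "length (?l x) = 4" by (simp add: case_prod_beta)
    then show "real (card (?B x)) \<le> (2 * r / ?M) ^ 4 * card W"
      using coincidences_le[OF large, of "?l x"] x by (simp only: card_points mem_Collect_eq)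
  qed
  also have "\<dots> = real (card ?T) * ((2 * r / ?M) ^ 4 * card W)" by simp
  also have "\<dots> \<le> (?M * K) ^ 3 * ((2 * r / ?M) ^ 4 * card W)"
  proof (rule mult_right_mono)
    have "card ?P = (\<Sum>p\<in>points n k. k (fst p))" by (simp add: card_cartesian_product)
    also have "\<dots> \<le> (\<Sum>p\<in>points n k. K)" using k_le by (intro sum_mono) (auto simp: points_def)
    also have "\<dots> = M n k * K" by (simp add: card_points)
    finally have P: "card ?P \<le> M n k * K" .
    have "card ?T \<le> card (?P \<times> ?P \<times> ?P)" using finP by (intro card_mono) auto
    also have "\<dots> = card ?P ^ 3" by (simp only: card_cartesian_product power3_eq_cube mult.assoc)
    also have "\<dots> \<le> (M n k * K) ^ 3" using P by (rule power_mono) simp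
    finally have "real (card ?T) \<le> real ((M n k * K) ^ 3)" by (rule of_nat_mono)
    then show "real (card ?T) \<le> (?M * K) ^ 3" by simp
  qed simp
  also have "\<dots> = 16 * (r ^ 4 * K ^ 3 / ?M) * card W"
    using M_pos by (simp add: power_mult_distrib power_divide eval_nat_numeral)
  finally show ?thesis .
qed

text \<open>A loopless map fails to be simple only through a forbidden or a repeated edge; the
  constants 36 and 16 of the two cases are merged into 36.\<close>

lemma simple_maps_ge:
  assumes X: "finite X" "\<And>e. e \<in> X \<Longrightarrow> e \<subseteq> {1..n} \<and> card e = r"
  shows "real (card W) - card (simple_maps n r k m X)
    \<le> 36 * (r ^ 4 * K ^ 3 / M n k + card X * K ^ 3 / real (M n k) ^ 2) * card W"
proof -
  let ?G = "simple_maps n r k m X"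
  let ?F = "{b \<in> W. \<exists>c<m. edge_at n k b c \<in> X}"
  let ?R = "{b \<in> W. \<exists>c<m. \<exists>c'<m. c \<noteq> c' \<and> edge_at n k b c = edge_at n k b c'}"
  have "W \<subseteq> ?G \<union> (?F \<union> ?R)" by (auto simp: simple_maps_def inj_on_def)
  moreover have "finite ?G" using finite_W by (simp add: simple_maps_def)
  ultimately have "card W \<le> card (?G \<union> (?F \<union> ?R))" using finite_W by (intro card_mono) auto
  also have "\<dots> \<le> card ?G + (card ?F + card ?R)"
    by (meson card_Un_le add_left_mono order_trans)
  finally have "real (card W) \<le> real (card ?G + (card ?F + card ?R))" by (rule of_nat_mono)
  then have "real (card W) - card ?G \<le> real (card ?F) + real (card ?R)" by simp
  also have "\<dots> \<le> 36 * (card X * K ^ 3 / real (M n k) ^ 2) * card W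
      + 16 * (r ^ 4 * K ^ 3 / M n k) * card W"
    by (intro add_mono forbidden_edge_le[OF X] repeated_edge_le)
  also have "\<dots> \<le> 36 * (card X * K ^ 3 / real (M n k) ^ 2) * card W
      + 36 * (r ^ 4 * K ^ 3 / M n k) * card W"
    by (intro add_left_mono mult_right_mono) auto
  finally show ?thesis by (simp add: algebra_simps)
qed

text \<open>The number of simple configurations is the number of balanced maps, times the
  probability of having no loop, times the conditional probability \<open>1 - z\<close> of being
  simple; it is then divided by the number of configurations per hypergraph. The constant 82 = 10 +
  72 collects the errors of the two logarithms.\<close>

theorem card_hypergraphs_avoiding:
  assumes X: "finite X" "\<And>e. e \<in> X \<Longrightarrow> e \<subseteq> {1..n} \<and> card e = r"
    and small: "r ^ 4 * K ^ 3 / M n k + card X * K ^ 3 / real (M n k) ^ 2 \<le> 1 / 72"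
  shows "\<exists>\<delta>. \<bar>\<delta>\<bar> \<le> 82 * (r ^ 4 * K ^ 3 / M n k + card X * K ^ 3 / real (M n k) ^ 2) \<and>
    real (card {H \<in> hypergraphs_with_degrees n r k. H \<inter> X = {}})
      = fact (M n k) / (fact m * fact r ^ m * (\<Prod>i=1..n. fact (k i)))
        * exp (\<delta> - (real r - 1) / 2 * (M2 n k / M n k))"
proof -
  let ?M = "real (M n k)"
  define \<beta> where "\<beta> = r ^ 4 * K ^ 3 / ?M + card X * K ^ 3 / ?M ^ 2"
  define B where "B = real (card (balanced_maps (points n k) {..<m} r))"
  define w where "w = real (card W)"
  define s where "s = real (card (simple_maps n r k m X))"
  have B_fact: "B * fact r ^ m = fact (M n k)"
  proof -
    have "card (balanced_maps (points n k) {..<m} r) * fact r ^ m = fact (M n k)"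
      using card_balanced_maps[of "{..<m}" "points n k" r] M_eq by (simp add: card_points)
    then have "real (card (balanced_maps (points n k) {..<m} r) * fact r ^ m) = real (fact (M n k))"
      by (rule arg_cong)
    then show ?thesis by (simp add: B_def)
  qed
  then have B: "B > 0"
    using fact_gt_zero[of "M n k", where ?'a = real] by (cases "B = 0") (auto simp: B_def)
  then have ne: "balanced_maps (points n k) {..<m} r \<noteq> {}" by (auto simp: B_def)
  note proper = card_proper_maps[OF finite_points finite_lessThan finite_vertex_pairs
      vertex_pairs_doubleton degree_le large _ K_pos ne]
  have w: "w > 0" using proper(1) r_ge by (simp add: w_def)
  define \<delta>\<^sub>1 where "\<delta>\<^sub>1 = ln (w / B) + card (vertex_pairs n k) * ((real r - 1) / ?M)"
  have "M2 n k \<le> ?M * K"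
  proof -
    have "falling_factorial (real (k i)) 2 \<le> real (k i) * K" if "i \<in> {1..n}" for i
      using k_le[OF that] by (auto simp: falling_factorial_def numeral_2_eq_2 intro!: mult_left_mono)
    then have "M2 n k \<le> (\<Sum>i=1..n. real (k i) * K)" unfolding M2_def by (rule sum_mono)
    also have "\<dots> = ?M * K" by (simp add: M_def sum_distrib_right)
    finally show ?thesis .
  qed
  then have pairs: "card (vertex_pairs n k) \<le> ?M * K / 2" by (simp add: card_vertex_pairs)
  \<comment> \<open>With at most \<open>M n k * K / 2\<close> pairs, the errors add up to
    \<open>10 * r ^ 2 * K ^ 2 / M n k\<close>, which the first term of \<beta> absorbs.\<close>
  have "\<bar>\<delta>\<^sub>1\<bar> \<le> card (vertex_pairs n k) * (20 * real r ^ 2 * K / ?M ^ 2)"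
    using proper(2) r_ge by (simp add: \<delta>\<^sub>1_def w_def B_def card_points)
  also have "\<dots> \<le> ?M * K / 2 * (20 * real r ^ 2 * K / ?M ^ 2)"
    using pairs by (rule mult_right_mono) simp
  also have "\<dots> = 10 * ((real r ^ 2 * real K ^ 2) / ?M)"
    using M_pos by (simp add: power2_eq_square)
  also have "\<dots> \<le> 10 * ((real r ^ 4 * real K ^ 3) / ?M)"
    using r_ge K_pos
    by (intro mult_left_mono divide_right_mono mult_mono power_increasing) auto
  also have "\<dots> \<le> 10 * \<beta>" by (simp add: \<beta>_def)
  finally have \<delta>\<^sub>1: "\<bar>\<delta>\<^sub>1\<bar> \<le> 10 * \<beta>" .

  define z where "z = (w - s) / w"
  have "w - s \<le> 36 * \<beta> * w"
    using simple_maps_ge[OF X] by (simp only: w_def s_def \<beta>_def)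
  then have z: "z \<le> 36 * \<beta>" using w by (simp add: z_def pos_divide_le_eq)
  have "s \<le> w"
    unfolding s_def w_def
    by (intro of_nat_mono card_mono finite_W) (auto simp: simple_maps_def)
  then have z0: "z \<ge> 0" using w by (simp add: z_def)
  \<comment> \<open>The threshold makes \<open>36 * \<beta> \<le> 1 / 2\<close>; then
    \<open>\<bar>ln (1 - z)\<bar> \<le> 2 * z\<close>, whence the constant 72.\<close>
  have "\<beta> \<le> 1 / 72" using small by (simp only: \<beta>_def)
  then have z_half: "z \<le> 1 / 2" using z by simp
  have "\<bar>ln (1 + - z) - - z\<bar> \<le> 2 * (- z)\<^sup>2"
    using z0 z_half by (intro abs_ln_one_plus_x_minus_x_bound) auto
  also have "2 * (- z)\<^sup>2 = (2 * z) * z" by (simp add: power2_eq_square)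
  also have "\<dots> \<le> 1 * z" using z0 z_half by (intro mult_right_mono) auto
  finally have ln_z: "\<bar>ln (1 - z)\<bar> \<le> 72 * \<beta>" using z z0 by simp
  have "s = B * (w / B) * (1 - z)" using B w by (simp add: z_def field_simps)
  also have "\<dots> = B * exp (ln (w / B)) * exp (ln (1 - z))" using B w z_half by simp
  also have "\<dots> = B * exp (\<delta>\<^sub>1 + ln (1 - z) - (real r - 1) / 2 * (M2 n k / ?M))"
    by (simp add: \<delta>\<^sub>1_def card_vertex_pairs exp_add[symmetric] mult.assoc)
  finally have s: "s = B * exp (\<delta>\<^sub>1 + ln (1 - z) - (real r - 1) / 2 * (M2 n k / ?M))" .
  have "s = fact m * (\<Prod>i=1..n. fact (k i))
      * real (card {H \<in> hypergraphs_with_degrees n r k. H \<inter> X = {}})"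
    using card_simple_maps[OF M_eq, of X] r_ge by (simp add: s_def)
  then have "real (card {H \<in> hypergraphs_with_degrees n r k. H \<inter> X = {}})
      = s / (fact m * (\<Prod>i=1..n. fact (k i)))" by simp
  also have "\<dots> = fact (M n k) / (fact m * fact r ^ m * (\<Prod>i=1..n. fact (k i)))
      * exp (\<delta>\<^sub>1 + ln (1 - z) - (real r - 1) / 2 * (M2 n k / ?M))"
    unfolding s B_fact[symmetric] by simp
  finally have "real (card {H \<in> hypergraphs_with_degrees n r k. H \<inter> X = {}})
      = fact (M n k) / (fact m * fact r ^ m * (\<Prod>i=1..n. fact (k i)))
      * exp (\<delta>\<^sub>1 + ln (1 - z) - (real r - 1) / 2 * (M2 n k / ?M))" .
  moreover have "\<bar>\<delta>\<^sub>1 + ln (1 - z)\<bar> \<le> 82 * \<beta>" using \<delta>\<^sub>1 ln_z by linarith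
  ultimately show ?thesis unfolding \<beta>_def by blast
qed

end

section \<open>Hypergraphs containing a given hypergraph\<close>

lemma falling_factorial_nat:
  assumes "b \<le> a"
  shows "falling_factorial (real a) b = fact a / fact (a - b)"
  using assms
proof (induction b)
  case (Suc b)
  have "fact (a - b) = (real a - real b) * fact (a - Suc b)"
    using Suc.prems by (simp add: fact_reduce[of "a - b"] of_nat_diff)
  moreover have "falling_factorial (real a) (Suc b) = falling_factorial (real a) b * (real a - real b)"
    by (simp add: falling_factorial_def)
  moreover have "real a - real b \<noteq> 0" using Suc.prems by simp
  ultimately show ?case using Suc by simp
qed (simp add: falling_factorial_def)

text \<open>Deleting and restoring the edges of \<open>X\<close> are inverse operations, and they
  shift each degree by the degree in \<open>X\<close>.\<close>

lemma card_hypergraphs_containing: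
  assumes X: "X \<in> hypergraphs_with_degrees n r x" and xk: "\<And>i. i \<in> {1..n} \<Longrightarrow> x i \<le> k i"
  shows "card {H \<in> hypergraphs_with_degrees n r k. X \<subseteq> H}
    = card {H \<in> hypergraphs_with_degrees n r (\<lambda>i. k i - x i). H \<inter> X = {}}"
proof -
  note X' = hypergraph_edges[OF X]
  have "bij_betw (\<lambda>H. H - X) {H \<in> hypergraphs_with_degrees n r k. X \<subseteq> H}
      {H \<in> hypergraphs_with_degrees n r (\<lambda>i. k i - x i). H \<inter> X = {}}"
  proof (rule bij_betw_byWitness[where f' = "\<lambda>H. H \<union> X"])
    show "(\<lambda>H. H - X) ` {H \<in> hypergraphs_with_degrees n r k. X \<subseteq> H}
        \<subseteq> {H \<in> hypergraphs_with_degrees n r (\<lambda>i. k i - x i). H \<inter> X = {}}"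
    proof (rule image_subsetI)
      fix H assume "H \<in> {H \<in> hypergraphs_with_degrees n r k. X \<subseteq> H}"
      then have H: "H \<in> hypergraphs_with_degrees n r k" and sub: "X \<subseteq> H" by auto
      have "card {e \<in> H - X. i \<in> e} = k i - x i" if i: "i \<in> {1..n}" for i
      proof -
        have "{e \<in> H - X. i \<in> e} = {e \<in> H. i \<in> e} - {e \<in> X. i \<in> e}" by auto
        moreover have "card ({e \<in> H. i \<in> e} - {e \<in> X. i \<in> e})
            = card {e \<in> H. i \<in> e} - card {e \<in> X. i \<in> e}"
          using X'(1) sub by (intro card_Diff_subset) auto
        ultimately show ?thesis using hypergraph_edges(4)[OF H i] X'(4)[OF i] by simp
      qed
      then show "H - X \<in> {H \<in> hypergraphs_with_degrees n r (\<lambda>i. k i - x i). H \<inter> X = {}}"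
        using hypergraph_edges(2,3)[OF H]
        by (auto simp: hypergraphs_with_degrees_def simple_uniform_hypergraphs_def hdegree_def)
    qed
    show "(\<lambda>H. H \<union> X) ` {H \<in> hypergraphs_with_degrees n r (\<lambda>i. k i - x i). H \<inter> X = {}}
        \<subseteq> {H \<in> hypergraphs_with_degrees n r k. X \<subseteq> H}"
    proof (rule image_subsetI)
      fix H assume "H \<in> {H \<in> hypergraphs_with_degrees n r (\<lambda>i. k i - x i). H \<inter> X = {}}"
      then have H: "H \<in> hypergraphs_with_degrees n r (\<lambda>i. k i - x i)" and disj: "H \<inter> X = {}" by auto
      have "card {e \<in> H \<union> X. i \<in> e} = k i" if i: "i \<in> {1..n}" for i
      proof -
        have "{e \<in> H \<union> X. i \<in> e} = {e \<in> H. i \<in> e} \<union> {e \<in> X. i \<in> e}" by auto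
        moreover have "card ({e \<in> H. i \<in> e} \<union> {e \<in> X. i \<in> e})
            = card {e \<in> H. i \<in> e} + card {e \<in> X. i \<in> e}"
          using X'(1) hypergraph_edges(1)[OF H] disj by (intro card_Un_disjoint) auto
        ultimately show ?thesis
          using hypergraph_edges(4)[OF H i] X'(4)[OF i] xk[OF i] by simp
      qed
      moreover have "e \<subseteq> {1..n} \<and> card e = r" if "e \<in> H \<union> X" for e
        using that hypergraph_edges(2,3)[OF H, of e] X'(2,3)[of e] by (cases "e \<in> X") auto
      ultimately show "H \<union> X \<in> {H \<in> hypergraphs_with_degrees n r k. X \<subseteq> H}"
        by (simp add: hypergraphs_with_degrees_def simple_uniform_hypergraphs_def hdegree_def)
    qed
  qed auto
  then show ?thesis by (rule bij_betw_same_card)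
qed

text \<open>The estimate at a fixed \<open>n\<close> with explicit constants. The count for k - x
  avoiding \<open>X\<close> is divided by the count for k with nothing forbidden; each contributes
  an error of 82 \<beta>.\<close>

lemma prob_containing:
  assumes r: "r \<ge> 3" and n: "n \<ge> 1" and dvd: "r dvd M n k"
    and X: "X \<in> hypergraphs_with_degrees n r x" and t: "card X = t"
    and xk: "\<And>i. i \<in> {1..n} \<Longrightarrow> x i \<le> k i"
    and pos: "M n (\<lambda>i. k i - x i) > 0"
    and small: "beta n r k x t \<le> 1 / 72"
  shows "\<exists>\<delta>. \<bar>\<delta>\<bar> \<le> 164 * beta n r k x t \<and>
      hypergraphs_with_degrees n r k \<noteq> {} \<and>
      measure_pmf.prob (pmf_of_set (hypergraphs_with_degrees n r k)) {H. X \<subseteq> H} =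
        falling_factorial (real (M n k) / real r) t * fact r ^ t
          * (\<Prod>i=1..n. falling_factorial (real (k i)) (x i))
          / falling_factorial (real (M n k)) (r * t)
        * exp ((real r - 1) / 2
            * (M2 n k / real (M n k)
               - M2 n (\<lambda>i. k i - x i) / real (M n (\<lambda>i. k i - x i)))
            + \<delta>)"
proof -
  let ?k' = "\<lambda>i. k i - x i"
  define K where "K = k_max n k"
  define m where "m = M n k div r"
  define M' where "M' = M n ?k'"
  define m' where "m' = m - t"
  define \<beta> where "\<beta> = beta n r k x t"
  note e = hypergraph_edges[OF X]
  have kK: "k i \<le> K" if "i \<in> {1..n}" for i
    using that unfolding K_def k_max_def by (intro Max_ge) auto
  have Mx: "M n x = r * t" using handshake[OF X] t by simp
  have "M' + M n x = M n k"
    unfolding M'_def M_def sum.distrib[symmetric] using xk by (intro sum.cong) auto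
  then have MM: "M n k = M' + r * t" using Mx by simp
  have Mm: "M n k = r * m" using dvd by (simp add: m_def)
  have "M' = r * m - r * t" using MM Mm by simp
  then have Mm': "M' = r * m'" by (simp add: m'_def diff_mult_distrib2)
  have M'pos: "M' > 0" using pos by (simp add: M'_def)
  \<comment> \<open>The subtraction in \<open>m'\<close> is truncated, but \<open>t > m\<close>
    would make \<open>M'\<close> vanish, against its positivity.\<close>
  then have tm: "t \<le> m" using Mm' by (cases "t \<le> m") (simp_all add: m'_def)
  have \<beta>1: "r ^ 4 * K ^ 3 / M' + t * K ^ 3 / real M' ^ 2 \<le> \<beta>"
    unfolding \<beta>_def beta_def K_def M'_def by simp
  then have "r ^ 4 * K ^ 3 / M' \<le> \<beta>" by (smt (verit) divide_nonneg_nonneg of_nat_0_le_iff zero_le_power)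
  \<comment> \<open>Removing \<open>X\<close> can only lower the degree sum, so the sparsity of k -
    x carries over to k.\<close>
  moreover have "r ^ 4 * K ^ 3 / M n k \<le> r ^ 4 * K ^ 3 / M'"
    using M'pos MM by (intro divide_left_mono) (auto intro!: mult_pos_pos add_pos_nonneg)
  ultimately have \<beta>2: "r ^ 4 * K ^ 3 / M n k \<le> \<beta>" and \<beta>3: "r ^ 4 * K ^ 3 / M' \<le> 1"
    using small by (auto simp: \<beta>_def[symmetric])
  have "real (r ^ 4 * K ^ 3) \<le> real M'" using \<beta>3 M'pos by (simp add: field_simps)
  then have sparse': "r ^ 4 * K ^ 3 \<le> M'" by (simp only: of_nat_le_iff)

  \<comment> \<open>\<open>A\<close> yields the numerator and \<open>B\<close> the denominator, both
    with the maximum of k as degree bound.\<close>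
  interpret A: sparse_degrees n r m' K ?k'
    by unfold_locales
      (use kK r Mm' pos sparse' in \<open>auto simp: M'_def[symmetric] intro: order_trans[OF diff_le_self]\<close>)
  interpret B: sparse_degrees n r m K k
  proof
    show "M n k > 0" "r ^ 4 * K ^ 3 \<le> M n k" using MM M'pos sparse' by simp_all
  qed (use kK r Mm in auto)

  have eX: "e \<subseteq> {1..n} \<and> card e = r" if "e \<in> X" for e using e(2,3)[OF that] by blast
  have small1: "r ^ 4 * K ^ 3 / M n ?k' + card X * K ^ 3 / real (M n ?k') ^ 2 \<le> 1 / 72"
    using \<beta>1 small unfolding t M'_def \<beta>_def by linarith
  obtain \<delta>\<^sub>1 where \<delta>\<^sub>1: "\<bar>\<delta>\<^sub>1\<bar> \<le> 82 * (r ^ 4 * K ^ 3 / M' + t * K ^ 3 / real M' ^ 2)"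
    and num: "real (card {H \<in> hypergraphs_with_degrees n r ?k'. H \<inter> X = {}})
      = fact M' / (fact m' * fact r ^ m' * (\<Prod>i=1..n. fact (k i - x i)))
        * exp (\<delta>\<^sub>1 - (real r - 1) / 2 * (M2 n ?k' / M'))"
    using A.card_hypergraphs_avoiding[OF e(1) eX small1] unfolding t M'_def by blast
  have small2: "r ^ 4 * K ^ 3 / M n k + card {} * K ^ 3 / real (M n k) ^ 2 \<le> 1 / 72"
    using order_trans[OF \<beta>2[unfolded \<beta>_def] small] by simp
  obtain \<delta>\<^sub>2 where \<delta>\<^sub>2: "\<bar>\<delta>\<^sub>2\<bar> \<le> 82 * (r ^ 4 * K ^ 3 / M n k)"
    and den: "real (card (hypergraphs_with_degrees n r k))
      = fact (M n k) / (fact m * fact r ^ m * (\<Prod>i=1..n. fact (k i)))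
        * exp (\<delta>\<^sub>2 - (real r - 1) / 2 * (M2 n k / M n k))"
    using B.card_hypergraphs_avoiding[of "{}"] small2 by auto
  let ?Hs = "hypergraphs_with_degrees n r k"
  \<comment> \<open>Existence of a hypergraph with degrees k follows from the count itself, a
    quotient of factorials times an exponential.\<close>
  have "real (card ?Hs) \<noteq> 0" unfolding den by simp
  then have ne: "?Hs \<noteq> {}" by auto
  have "measure_pmf.prob (pmf_of_set ?Hs) {H. X \<subseteq> H} = real (card {H \<in> ?Hs. X \<subseteq> H}) / card ?Hs"
    using ne finite_hypergraphs by (simp add: measure_pmf_of_set Int_def)
  also have "\<dots> = (fact M' / (fact m' * fact r ^ m' * (\<Prod>i=1..n. fact (k i - x i)))
        * exp (\<delta>\<^sub>1 - (real r - 1) / 2 * (M2 n ?k' / M')))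
      / (fact (M n k) / (fact m * fact r ^ m * (\<Prod>i=1..n. fact (k i)))
        * exp (\<delta>\<^sub>2 - (real r - 1) / 2 * (M2 n k / M n k)))"
    by (simp only: card_hypergraphs_containing[OF X xk] num den)
  also have "\<dots> = (fact M' / (fact m' * fact r ^ m' * (\<Prod>i=1..n. fact (k i - x i))))
      / (fact (M n k) / (fact m * fact r ^ m * (\<Prod>i=1..n. fact (k i))))
      * (exp (\<delta>\<^sub>1 - (real r - 1) / 2 * (M2 n ?k' / M'))
      / exp (\<delta>\<^sub>2 - (real r - 1) / 2 * (M2 n k / M n k)))"
    by (simp only: times_divide_times_eq)
  also have "exp (\<delta>\<^sub>1 - (real r - 1) / 2 * (M2 n ?k' / M'))
      / exp (\<delta>\<^sub>2 - (real r - 1) / 2 * (M2 n k / M n k))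
      = exp ((real r - 1) / 2 * (M2 n k / M n k - M2 n ?k' / M') + (\<delta>\<^sub>1 - \<delta>\<^sub>2))"
    unfolding exp_diff[symmetric] by (simp add: algebra_simps)
  also have "(fact M' / (fact m' * fact r ^ m' * (\<Prod>i=1..n. fact (k i - x i))))
      / (fact (M n k) / (fact m * fact r ^ m * (\<Prod>i=1..n. fact (k i))))
      = falling_factorial (real (M n k) / real r) t * fact r ^ t
          * (\<Prod>i=1..n. falling_factorial (real (k i)) (x i))
          / falling_factorial (real (M n k)) (r * t)"
  proof -
    have 1: "falling_factorial (real (M n k) / real r) t = fact m / fact m'"
      using falling_factorial_nat[OF tm] r Mm by (simp add: m'_def)
    have 2: "falling_factorial (real (M n k)) (r * t) = fact (M n k) / fact M'"
      using falling_factorial_nat[of "r * t" "M n k"] MM by simp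
    have 3: "(\<Prod>i=1..n. falling_factorial (real (k i)) (x i))
        = (\<Prod>i=1..n. fact (k i)) / (\<Prod>i=1..n. fact (k i - x i))"
      using xk by (simp add: falling_factorial_nat prod_dividef[symmetric])
    have 4: "fact r ^ m = (fact r ^ m' * fact r ^ t :: real)"
      using tm by (simp add: m'_def power_add[symmetric])
    show ?thesis unfolding 1 2 3 4 by (simp add: field_simps)
  qed
  finally have "measure_pmf.prob (pmf_of_set ?Hs) {H. X \<subseteq> H} =
        falling_factorial (real (M n k) / real r) t * fact r ^ t
          * (\<Prod>i=1..n. falling_factorial (real (k i)) (x i))
          / falling_factorial (real (M n k)) (r * t)
        * exp ((real r - 1) / 2 * (M2 n k / M n k - M2 n ?k' / M n ?k') + (\<delta>\<^sub>1 - \<delta>\<^sub>2))"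
    unfolding M'_def .
  moreover have "\<bar>\<delta>\<^sub>1 - \<delta>\<^sub>2\<bar> \<le> 164 * \<beta>"
  proof -
    have "\<bar>\<delta>\<^sub>1\<bar> \<le> 82 * \<beta>" by (rule order_trans[OF \<delta>\<^sub>1]) (rule mult_left_mono[OF \<beta>1], simp)
    moreover have "\<bar>\<delta>\<^sub>2\<bar> \<le> 82 * \<beta>"
      by (rule order_trans[OF \<delta>\<^sub>2]) (rule mult_left_mono[OF \<beta>2], simp)
    ultimately show ?thesis by linarith
  qed
  ultimately show ?thesis using ne unfolding \<beta>_def by blast
qed

section \<open>Passage to the limit\<close>

theorem corollary1p2:
  fixes r t :: "nat \<Rightarrow> nat"
    and k x :: "nat \<Rightarrow> nat \<Rightarrow> nat"
    and X :: "nat \<Rightarrow> nat set set"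
    and N :: "nat set"
  assumes r_ge_3: "\<And>n. n \<ge> 3 \<Longrightarrow> r n \<ge> 3"
    and N_eq: "N = {n. n \<ge> 3 \<and> r n dvd M n (k n)}"
    and N_infinite: "infinite N"
    and X: "\<And>n. n \<in> N \<Longrightarrow> X n \<in> hypergraphs_with_degrees n (r n) (x n)"
    and t: "\<And>n. n \<in> N \<Longrightarrow> card (X n) = t n"
    and x_le_k: "\<And>n i. n \<in> N \<Longrightarrow> i \<in> {1..n} \<Longrightarrow> x n i \<le> k n i"
    and beta_defined: "\<forall>\<^sub>F n in to_infinity_along N. M n (\<lambda>i. k n i - x n i) > 0"
    and beta_small:
      "(\<lambda>n. beta n (r n) (k n) (x n) (t n)) \<in> o[to_infinity_along N](\<lambda>_. 1)"
  shows "\<exists>\<delta> :: nat \<Rightarrow> real.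
    \<delta> \<in> O[to_infinity_along N](\<lambda>n. beta n (r n) (k n) (x n) (t n)) \<and>
    (\<forall>\<^sub>F n in to_infinity_along N.
      hypergraphs_with_degrees n (r n) (k n) \<noteq> {} \<and>
      measure_pmf.prob (pmf_of_set (hypergraphs_with_degrees n (r n) (k n))) {H. X n \<subseteq> H} =
        falling_factorial (real (M n (k n)) / real (r n)) (t n) * fact (r n) ^ t n
          * (\<Prod>i=1..n. falling_factorial (real (k n i)) (x n i))
          / falling_factorial (real (M n (k n))) (r n * t n)
        * exp ((real (r n) - 1) / 2
            * (M2 n (k n) / real (M n (k n))
               - M2 n (\<lambda>i. k n i - x n i) / real (M n (\<lambda>i. k n i - x n i)))
            + \<delta> n))"
    (is "\<exists>\<delta>. _ \<and> (\<forall>\<^sub>F n in _. ?P n (\<delta> n))")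
proof -
  let ?\<beta> = "\<lambda>n. beta n (r n) (k n) (x n) (t n)"
  have "\<forall>\<^sub>F n in to_infinity_along N. n \<in> N"
    by (simp add: to_infinity_along_def eventually_inf_principal)
  moreover have "\<forall>\<^sub>F n in to_infinity_along N. ?\<beta> n \<le> 1 / 72"
    using landau_o.smallD[OF beta_small, of "1 / 72"] by (rule eventually_mono) auto
  ultimately have ev: "\<forall>\<^sub>F n in to_infinity_along N. \<exists>d. \<bar>d\<bar> \<le> 164 * ?\<beta> n \<and> ?P n d"
    using beta_defined
  proof eventually_elim
    case (elim n)
    then have n: "n \<ge> 3" "r n dvd M n (k n)" by (auto simp: N_eq)
    show ?case
      by (rule prob_containing[OF r_ge_3[OF n(1)] _ n(2) X[OF elim(1)] t[OF elim(1)]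
            x_le_k[OF elim(1)] elim(3,2)]) (use n in auto)
  qed
  \<comment> \<open>The bounds hold for each late \<open>n\<close> separately with the same constant
    164; choosing one error term per \<open>n\<close> yields a function that is O(\<beta>).\<close>
  define \<delta> where "\<delta> = (\<lambda>n. SOME d. \<bar>d\<bar> \<le> 164 * ?\<beta> n \<and> ?P n d)"
  have \<delta>: "\<forall>\<^sub>F n in to_infinity_along N. \<bar>\<delta> n\<bar> \<le> 164 * ?\<beta> n \<and> ?P n (\<delta> n)"
    using ev unfolding \<delta>_def by (rule eventually_mono) (rule someI_ex)
  have "\<delta> \<in> O[to_infinity_along N](?\<beta>)"
    by (rule landau_o.bigI[of 164]) (use \<delta> in \<open>auto elim!: eventually_mono\<close>)
  moreover have "\<forall>\<^sub>F n in to_infinity_along N. ?P n (\<delta> n)"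
    using \<delta> by (rule eventually_mono) (rule conjunct2)
  ultimately show ?thesis by blast
qed

end
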